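(* Let $X$ be a separable Banach space and $\alpha \in (0,\omega_1)$. Assume that $Y$ is a Banach space and that $Y$ bi-Lipschitz embeds into $X$. Then (1) $DT(X)>\alpha$ if and only if $D_\alpha^2$ sub-Lipschitz embeds into $X$. (2) $DT(Y)\le DT(X)$. (3) If $X$ fails the Infinite Tree Property, so does $Y$.
   Context: All Banach spaces are real; $B_X$ is the closed unit ball. $\omega=\{0,1,2,\dots\}$, $\omega_1$ is the first uncountable ordinal. For every limit ordinal $\alpha<\omega_1$ fix once and for all an enumeration $(\beta_n)_{n\in\omega}$ of all ordinals less than $\alpha$. For finite sequences $s,t$, $s\cdot t$ denotes their concatenation ($s$ followed by $t$); a single element $a$ is identified with the one-term sequence consisting of $a$, and $a\cdot T=\{a\cdot t:t\in T\}$ for a set $T$ of finite sequences. **Dyadic trees.** Sets $T_\alpha$ ($\alpha<\omega_1$) of finite sequences in $\omega$ are defined by: $T_0=\{\varnothing\}$; $T_{\alpha+1}=\{\varnothing\}\cup 0\cdot T_\alpha\cup 1\cdot T_\alpha$; for $\alpha$ limit, $T_\alpha=\{\varnothing\}\cup\bigcup_{n\in\omega} n\cdot T_{\beta_n}$. Every $s\in T_\alpha$ has in $T_\alpha$ either no successor, exactly the two successors $s\cdot 0,s\cdot 1$, or the successors $s\cdot n$ for all $n\in\omega$. For $\delta>0$, a $\delta$-$\alpha$-tree in $X$ is a family $(x_s)_{s\in T_\alpha}\subset X$ such that: if $s$ has exactly two successors then $x_s=\frac12(x_{s\cdot 0}+x_{s\cdot 1})$ and $\|x_{s\cdot 0}-x_s\|=\|x_{s\cdot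 1}-x_s\|=\frac12\|x_{s\cdot 0}-x_{s\cdot 1}\|\ge\delta$; if $s$ has infinitely many successors then $x_s=x_{s\cdot n}$ for all $n\in\omega$. **Index $DT$.** For separable $X$ and $\delta>0$, $DT(X,\delta)=\inf\{\alpha<\omega_1: B_X \text{ does not contain a } \delta\text{-}\alpha\text{-tree}\}$ if this set is nonempty, and $DT(X,\delta)=\infty$ otherwise (with $\alpha<\infty$ for all ordinals $\alpha$); $DT(X)=\sup_{\delta>0}DT(X,\delta)$. **Infinite Tree Property.** $X$ has it if there exist $\delta>0$ and $f:\{0,1\}^{<\omega}\to B_X$ (defined on all finite $0$-$1$ sequences) such that for all $s$, $f(s)=\frac12(f(s\cdot 0)+f(s\cdot 1))$ and $\frac12\|f(s\cdot 0)-f(s\cdot 1)\|\ge\delta$. **Dyadic diamonds** ($\kappa=2$). Metric spaces $(D_\alpha^\kappa,d_\alpha)$ with distinguished points $t_\alpha$ (top), $b_\alpha$ (bottom), satisfying $d_\alpha(t_\alpha,b_\alpha)=1$, are defined inductively. $D_0^\kappa=\{t_0,b_0\}$ with $d_0(t_0,b_0)=1$. $D_1^\kappa=\{t_1,b_1\}\cup\{x_1^i:0\le i<\kappa\}$ with the complete bipartite graph structure between $\{t_1,b_1\}$ and $\{x_1^i:i<\kappa\}$, and $d_1$ is $\frac12$ times the shortest path metric. $D_{\alpha+1}^\kappa$ is obtained from $D_1^\kappa$ (the "original $D_1^\kappa$", with points now denoted $t_{\alpha+1},b_{\alpha+1},x_{\alpha+1}^i$) by replacing each edge $\{t_1,x_1^i\}$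 by a copy $D_\alpha^{(i,+)}$ of $D_\alpha^\kappa$ whose top is $t_{\alpha+1}$ and whose bottom is $x^i_{\alpha+1}$, and each edge $\{x_1^i,b_1\}$ by a copy $D_\alpha^{(i,-)}$ whose top is $x_{\alpha+1}^i$ and whose bottom is $b_{\alpha+1}$; each copy carries the metric $\frac12 d_\alpha$ and $d_{\alpha+1}$ is the resulting shortest path metric. For $\alpha$ limit, $D_\alpha^\kappa$ is the disjoint union of the $D_{\beta_n}^\kappa$, $n\in\omega$, in which all tops $t_{\beta_n}$ are identified to $t_\alpha$ and all bottoms $b_{\beta_n}$ to $b_\alpha$; $d_\alpha$ equals $d_{\beta_n}$ on each $D_{\beta_n}^\kappa$ and is extended as the shortest path metric. **Active pairs.** $AP_0^\kappa=\{\{t_0,b_0\}\}$; $AP_1^\kappa$ is the set of all two-element subsets of $D_1^\kappa$; $AP_{\alpha+1}^\kappa$ is the union of the set of all two-element subsets of the original $D_1^\kappa$ in $D_{\alpha+1}^\kappa$ and of the active pairs of each copy $D_\alpha^{(i,\pm)}$ of $D_\alpha^\kappa$; for $\alpha$ limit, $AP_\alpha^\kappa=\bigcup_n AP_{\beta_n}^\kappa$. $D_\alpha^\kappa$ *sub-Lipschitz embeds* into $X$ if there are $A,B>0$ and $f:D_\alpha^\kappa\to X$ with $A\,d_\alpha(u,v)\le\|f(u)-f(v)\|\le B\,d_\alpha(u,v)$ for all $\{u,v\}\in AP_\alpha^\kappa$. *)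

theory Defs
  imports "HOL-Analysis.Analysis" "HOL-Library.Countable_Set_Type"
begin

section \<open>Countable ordinals\<close>

text \<open>The elements of \<open>omega1\<close> are the countable ordinals: the order is that of
  \<open>cardSuc natLeq\<close>, the least cardinal (as a well-order) above \<open>\<omega>\<close>.\<close>

typedef omega1 = "Field (cardSuc natLeq)"
proof -
  have "infinite (Field (cardSuc natLeq))"
    using cardSuc_finite[OF natLeq_Card_order] by (simp add: Field_natLeq)
  then show ?thesis by (metis ex_in_conv finite.emptyI)
qed

instantiation omega1 :: wellorder
begin

definition less_eq_omega1 :: "omega1 \<Rightarrow> omega1 \<Rightarrow> bool" where
  "a \<le> b \<longleftrightarrow> (Rep_omega1 a, Rep_omega1 b) \<in> cardSuc natLeq"

definition less_omega1 :: "omega1 \<Rightarrow> omega1 \<Rightarrow> bool" where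
  "(a::omega1) < b \<longleftrightarrow> a \<le> b \<and> \<not> b \<le> a"

instance
proof -
  have wo: "Well_order (cardSuc natLeq)"
    by (simp add: cardSuc_Well_order natLeq_Card_order)
  have refl: "(x, x) \<in> cardSuc natLeq" if "x \<in> Field (cardSuc natLeq)" for x
    using wo that by (auto simp: order_on_defs refl_on_def)
  have tr: "trans (cardSuc natLeq)" and as: "antisym (cardSuc natLeq)"
    and tot: "Total (cardSuc natLeq)"
    using wo by (auto simp: order_on_defs)
  have wf: "wf (cardSuc natLeq - Id)"
    using wo by (simp add: well_order_on_def)
  have asym: "a = b" if "a \<le> b" "b \<le> a" for a b :: omega1
    using as that unfolding less_eq_omega1_def antisym_def by (metis Rep_omega1_inject)
  have wf': "wf {(a, b :: omega1). a < b}"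
  proof (rule wf_subset[OF wf_inv_image[OF wf, of Rep_omega1]])
    show "{(a, b). a < b} \<subseteq> inv_image (cardSuc natLeq - Id) Rep_omega1"
      using less_eq_omega1_def less_omega1_def by (auto simp: inv_image_def)
  qed
  show "OFCLASS(omega1, wellorder_class)"
  proof
    fix a b c :: omega1
    show "a < b \<longleftrightarrow> a \<le> b \<and> \<not> b \<le> a" by (rule less_omega1_def)
    show "a \<le> a" using refl Rep_omega1 by (simp add: less_eq_omega1_def)
    show "a \<le> c" if "a \<le> b" "b \<le> c"
      using that tr unfolding less_eq_omega1_def by (blast dest: transD)
    show "a = b" if "a \<le> b" "b \<le> a" using asym that .
    show "a \<le> b \<or> b \<le> a"
    proof (cases "a = b")
      case True then show ?thesis using refl Rep_omega1 by (simp add: less_eq_omega1_def)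
    next
      case False then show ?thesis
        using tot Rep_omega1 unfolding less_eq_omega1_def total_on_def
        by (metis Rep_omega1_inject)
    qed
  next
    fix P :: "omega1 \<Rightarrow> bool" and a
    assume "\<And>x. (\<And>y. y < x \<Longrightarrow> P y) \<Longrightarrow> P x"
    then show "P a" using wf_induct[OF wf', of P a] by auto
  qed
qed

end

lemma countable_initial_segment:
  includes cardinal_syntax
  shows "countable {..< a :: omega1}"
proof -
  let ?r = "cardSuc natLeq"
  have "|underS ?r (Rep_omega1 a)| <o ?r"
    by (rule card_of_underS[OF cardSuc_Card_order[OF natLeq_Card_order] Rep_omega1])
  then have "|underS ?r (Rep_omega1 a)| \<le>o natLeq"
    using cardSuc_ordLess_ordLeq[OF natLeq_Card_order card_of_Card_order]
      cardSuc_ordLeq_ordLess[OF natLeq_Card_order card_of_Card_order] by blast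
  then have "countable (underS ?r (Rep_omega1 a))"
    by (simp add: countable_card_le_natLeq)
  moreover have "Rep_omega1 ` {..<a} \<subseteq> underS ?r (Rep_omega1 a)"
    by (auto simp: underS_def less_eq_omega1_def less_omega1_def order_less_imp_le
        Rep_omega1_inject)
  ultimately have "countable (Rep_omega1 ` {..<a})" using countable_subset by blast
  moreover have "inj_on Rep_omega1 {..<a}" by (simp add: inj_on_def Rep_omega1_inject)
  ultimately show ?thesis by (rule countable_image_inj_on)
qed

lemma uncountable_omega1:
  includes cardinal_syntax
  shows "uncountable (UNIV :: omega1 set)"
proof
  assume "countable (UNIV :: omega1 set)"
  then have "countable (range Rep_omega1)" by blast
  then have "countable (Field (cardSuc natLeq))"
    using type_definition.Rep_range[OF type_definition_omega1] by simp
  then have "|Field (cardSuc natLeq)| \<le>o natLeq"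
    by (simp add: countable_card_le_natLeq)
  moreover have "natLeq <o cardSuc natLeq"
    by (rule cardSuc_greater[OF natLeq_Card_order])
  moreover have "|Field (cardSuc natLeq)| =o cardSuc natLeq"
    by (rule card_of_Field_ordIso[OF cardSuc_Card_order[OF natLeq_Card_order]])
  ultimately show False
    using not_ordLess_ordLeq ordIso_symmetric ordIso_ordLeq_trans by blast
qed

lemma omega1_no_max: "\<exists>b. (a :: omega1) < b"
proof (rule ccontr)
  assume "\<not> ?thesis"
  then have "UNIV = insert a {..<a}" by (auto simp: not_less order_le_less)
  then show False
    using uncountable_omega1 countable_initial_segment countable_insert by metis
qed

instantiation omega1 :: zero
begin
definition zero_omega1 :: omega1 where "0 = (LEAST a :: omega1. True)"
instance ..
end

lemma zero_le_omega1: "(0 :: omega1) \<le> a"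
  by (simp add: zero_omega1_def Least_le)

definition osucc :: "omega1 \<Rightarrow> omega1" where
  "osucc a = (LEAST b. a < b)"

definition limit_ordinal :: "omega1 \<Rightarrow> bool" where
  "limit_ordinal a \<longleftrightarrow> a \<noteq> 0 \<and> (\<forall>b. a \<noteq> osucc b)"

lemma less_osucc: "a < osucc a"
  unfolding osucc_def using omega1_no_max LeastI_ex by metis

lemma osucc_le_iff: "osucc a \<le> b \<longleftrightarrow> a < b"
proof
  show "a < b" if "osucc a \<le> b" using less_osucc that by (rule less_le_trans)
  show "osucc a \<le> b" if "a < b" unfolding osucc_def using that by (rule Least_le)
qed

lemma osucc_inject: "osucc a = osucc b \<longleftrightarrow> a = b"
  by (metis less_osucc linorder_neqE not_le osucc_le_iff)

lemma osucc_neq_0: "osucc a \<noteq> 0"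
  by (metis less_osucc zero_le_omega1 not_le)

text \<open>A choice of an enumeration \<open>(\<beta>\<^sub>n)\<close> of the ordinals below \<open>\<alpha>\<close>, for every limit \<open>\<alpha>\<close>.\<close>

definition limit_enumeration :: "(omega1 \<Rightarrow> nat \<Rightarrow> omega1) \<Rightarrow> bool" where
  "limit_enumeration \<beta> \<longleftrightarrow> (\<forall>\<alpha>. limit_ordinal \<alpha> \<longrightarrow> range (\<beta> \<alpha>) = {..<\<alpha>})"

lemma limit_enumeration_exists: "\<exists>\<beta>. limit_enumeration \<beta>"
proof -
  have "range (from_nat_into {..<\<alpha>}) = {..<\<alpha>}" if "limit_ordinal \<alpha>" for \<alpha>
  proof -
    have "0 \<in> {..<\<alpha>}"
      using that zero_le_omega1[of \<alpha>] by (auto simp: limit_ordinal_def order_less_le)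
    then show ?thesis
      by (intro range_from_nat_into countable_initial_segment) auto
  qed
  then show ?thesis
    by (intro exI[of _ "\<lambda>\<alpha>. from_nat_into {..<\<alpha>}"]) (simp add: limit_enumeration_def)
qed

definition ord_rec ::
  "(omega1 \<Rightarrow> nat \<Rightarrow> omega1) \<Rightarrow> 'b \<Rightarrow> ('b \<Rightarrow> 'b) \<Rightarrow> ((nat \<Rightarrow> 'b) \<Rightarrow> 'b) \<Rightarrow> omega1 \<Rightarrow> 'b" where
  "ord_rec \<beta> z s l = wfrec {(a, b). a < b}
     (\<lambda>f \<alpha>. if \<alpha> = 0 then z
            else if \<exists>\<gamma>. \<alpha> = osucc \<gamma> then s (f (THE \<gamma>. \<alpha> = osucc \<gamma>))
            else l (\<lambda>n. f (\<beta> \<alpha> n)))"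

lemma ord_rec_0: "ord_rec \<beta> z s l 0 = z"
  by (subst ord_rec_def, subst wfrec) (auto simp: wf)

lemma ord_rec_osucc: "ord_rec \<beta> z s l (osucc \<alpha>) = s (ord_rec \<beta> z s l \<alpha>)"
proof -
  have "(THE \<gamma>. osucc \<alpha> = osucc \<gamma>) = \<alpha>" by (simp add: osucc_inject)
  then show ?thesis
    by (subst ord_rec_def, subst wfrec)
      (auto simp: wf osucc_neq_0 cut_def less_osucc ord_rec_def)
qed

lemma ord_rec_limit:
  assumes "limit_enumeration \<beta>" "limit_ordinal \<alpha>"
  shows "ord_rec \<beta> z s l \<alpha> = l (\<lambda>n. ord_rec \<beta> z s l (\<beta> \<alpha> n))"
proof -
  have "\<beta> \<alpha> n < \<alpha>" for n
    using assms unfolding limit_enumeration_def by (metis lessThan_iff rangeI)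
  then show ?thesis using assms(2)
    by (subst ord_rec_def, subst wfrec) (auto simp: wf limit_ordinal_def cut_def ord_rec_def)
qed

section \<open>Countable ordinals extended by \<open>\<infinity>\<close>\<close>

datatype ext_ord = Ord omega1 | Infty

instantiation ext_ord :: wellorder
begin

fun less_eq_ext_ord :: "ext_ord \<Rightarrow> ext_ord \<Rightarrow> bool" where
  "Ord a \<le> Ord b \<longleftrightarrow> a \<le> b"
| "_ \<le> Infty \<longleftrightarrow> True"
| "Infty \<le> Ord _ \<longleftrightarrow> False"

definition less_ext_ord :: "ext_ord \<Rightarrow> ext_ord \<Rightarrow> bool" where
  "(x::ext_ord) < y \<longleftrightarrow> x \<le> y \<and> \<not> y \<le> x"

instance
proof
  fix x y z :: ext_ord
  show "x < y \<longleftrightarrow> x \<le> y \<and> \<not> y \<le> x" by (rule less_ext_ord_def)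
  show "x \<le> x" by (cases x) auto
  show "x \<le> z" if "x \<le> y" "y \<le> z" using that by (cases x; cases y; cases z) auto
  show "x = y" if "x \<le> y" "y \<le> x" using that by (cases x; cases y) auto
  show "x \<le> y \<or> y \<le> x" by (cases x; cases y) auto
next
  fix P :: "ext_ord \<Rightarrow> bool" and x
  assume step: "\<And>x. (\<And>y. y < x \<Longrightarrow> P y) \<Longrightarrow> P x"
  have fin: "P (Ord a)" for a
  proof (induction a rule: less_induct)
    case (less a)
    have "P y" if "y < Ord a" for y
      using that less by (cases y) (auto simp: less_ext_ord_def not_le)
    then show ?case by (rule step)
  qed
  have "P Infty"
  proof (rule step)
    fix y assume "y < Infty"
    then show "P y" using fin by (cases y) (auto simp: less_ext_ord_def)
  qed
  then show "P x" using fin by (cases x) auto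
qed

end

instantiation ext_ord :: complete_linorder
begin

definition inf_ext_ord :: "ext_ord \<Rightarrow> ext_ord \<Rightarrow> ext_ord" where "inf_ext_ord = min"
definition sup_ext_ord :: "ext_ord \<Rightarrow> ext_ord \<Rightarrow> ext_ord" where "sup_ext_ord = max"
definition bot_ext_ord :: ext_ord where "bot_ext_ord = Ord 0"
definition top_ext_ord :: ext_ord where "top_ext_ord = Infty"
definition Inf_ext_ord :: "ext_ord set \<Rightarrow> ext_ord" where
  "Inf A = (if A = {} then Infty else LEAST x. x \<in> A)"
definition Sup_ext_ord :: "ext_ord set \<Rightarrow> ext_ord" where
  "Sup (A :: ext_ord set) = (LEAST x. \<forall>a\<in>A. a \<le> x)"

instance
proof
  have top: "x \<le> Infty" for x by (cases x) auto
  have ex: "\<forall>a\<in>A. a \<le> Infty" for A using top by blast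
  have bot: "Ord 0 \<le> x" for x by (cases x) (auto simp: zero_le_omega1)
  fix x y z :: ext_ord and A :: "ext_ord set"
  show "inf x y \<le> x" "inf x y \<le> y" by (auto simp: inf_ext_ord_def)
  show "x \<le> inf y z" if "x \<le> y" "x \<le> z" using that by (auto simp: inf_ext_ord_def)
  show "x \<le> sup x y" "y \<le> sup x y" by (auto simp: sup_ext_ord_def)
  show "sup y z \<le> x" if "y \<le> x" "z \<le> x" using that by (auto simp: sup_ext_ord_def)
  show "Inf A \<le> x" if "x \<in> A"
  proof -
    have "(LEAST x. x \<in> A) \<le> x" using that by (rule Least_le)
    then show ?thesis using that by (auto simp: Inf_ext_ord_def)
  qed
  show "z \<le> Inf A" if "\<And>x. x \<in> A \<Longrightarrow> z \<le> x"
  proof (cases "A = {}")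
    case True then show ?thesis using top by (simp add: Inf_ext_ord_def)
  next
    case False
    then have "(LEAST x. x \<in> A) \<in> A" by (metis LeastI ex_in_conv)
    then show ?thesis using that False by (simp add: Inf_ext_ord_def)
  qed
  show "x \<le> Sup A" if "x \<in> A"
    unfolding Sup_ext_ord_def
    using LeastI[where P="\<lambda>x. \<forall>a\<in>A. a \<le> x", OF ex] that by (rule bspec)
  show "Sup A \<le> z" if "\<And>x. x \<in> A \<Longrightarrow> x \<le> z"
    unfolding Sup_ext_ord_def by (rule Least_le) (use that in blast)
  show "Inf ({} :: ext_ord set) = top" by (simp add: Inf_ext_ord_def top_ext_ord_def)
  show "Sup ({} :: ext_ord set) = bot"
    unfolding Sup_ext_ord_def bot_ext_ord_def by (rule Least_equality) (simp_all add: bot)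
qed

end

section \<open>Dyadic trees and the index \<open>DT\<close>\<close>

definition tree :: "(omega1 \<Rightarrow> nat \<Rightarrow> omega1) \<Rightarrow> omega1 \<Rightarrow> nat list set" where
  "tree \<beta> = ord_rec \<beta> {[]}
     (\<lambda>T. {[]} \<union> Cons 0 ` T \<union> Cons 1 ` T)
     (\<lambda>T. {[]} \<union> (\<Union>n. Cons n ` T n))"

lemma tree_0: "tree \<beta> 0 = {[]}"
  by (simp add: tree_def ord_rec_0)

lemma tree_osucc:
  "tree \<beta> (osucc \<alpha>) = {[]} \<union> Cons 0 ` tree \<beta> \<alpha> \<union> Cons 1 ` tree \<beta> \<alpha>"
  by (simp add: tree_def ord_rec_osucc)

lemma tree_limit:
  "limit_enumeration \<beta> \<Longrightarrow> limit_ordinal \<alpha> \<Longrightarrow>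
     tree \<beta> \<alpha> = {[]} \<union> (\<Union>n. Cons n ` tree \<beta> (\<beta> \<alpha> n))"
  by (simp add: tree_def ord_rec_limit)

definition successors :: "nat list set \<Rightarrow> nat list \<Rightarrow> nat set" where
  "successors T s = {n. s @ [n] \<in> T}"

definition delta_tree ::
  "(omega1 \<Rightarrow> nat \<Rightarrow> omega1) \<Rightarrow> real \<Rightarrow> omega1 \<Rightarrow> (nat list \<Rightarrow> 'a::real_normed_vector) \<Rightarrow> bool" where
  "delta_tree \<beta> \<delta> \<alpha> x \<longleftrightarrow> (\<forall>s \<in> tree \<beta> \<alpha>.
     (successors (tree \<beta> \<alpha>) s = {0, 1} \<longrightarrow>
        x s = (1/2) *\<^sub>R (x (s @ [0]) + x (s @ [1])) \<and>
        norm (x (s @ [0]) - x s) = norm (x (s @ [1]) - x s) \<and>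
        norm (x (s @ [1]) - x s) = 1/2 * norm (x (s @ [0]) - x (s @ [1])) \<and>
        1/2 * norm (x (s @ [0]) - x (s @ [1])) \<ge> \<delta>) \<and>
     (infinite (successors (tree \<beta> \<alpha>) s) \<longrightarrow> (\<forall>n. x s = x (s @ [n]))))"

definition ball_contains_tree ::
  "(omega1 \<Rightarrow> nat \<Rightarrow> omega1) \<Rightarrow> 'a::real_normed_vector itself \<Rightarrow> real \<Rightarrow> omega1 \<Rightarrow> bool" where
  "ball_contains_tree \<beta> X \<delta> \<alpha> \<longleftrightarrow>
     (\<exists>x :: nat list \<Rightarrow> 'a. delta_tree \<beta> \<delta> \<alpha> x \<and> x ` tree \<beta> \<alpha> \<subseteq> cball 0 1)"

text \<open>The infimum of the empty set is \<open>Infty\<close>.\<close>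

definition DT_delta ::
  "(omega1 \<Rightarrow> nat \<Rightarrow> omega1) \<Rightarrow> 'a::real_normed_vector itself \<Rightarrow> real \<Rightarrow> ext_ord" where
  "DT_delta \<beta> X \<delta> = Inf (Ord ` {\<alpha>. \<not> ball_contains_tree \<beta> X \<delta> \<alpha>})"

definition DT ::
  "(omega1 \<Rightarrow> nat \<Rightarrow> omega1) \<Rightarrow> 'a::real_normed_vector itself \<Rightarrow> ext_ord" where
  "DT \<beta> X = (SUP \<delta>\<in>{0<..}. DT_delta \<beta> X \<delta>)"

definition infinite_tree_property :: "'a::real_normed_vector itself \<Rightarrow> bool" where
  "infinite_tree_property X \<longleftrightarrow>
     (\<exists>\<delta>>0. \<exists>f :: nat list \<Rightarrow> 'a. \<forall>s \<in> lists {0, 1}.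
        f s \<in> cball 0 1 \<and>
        f s = (1/2) *\<^sub>R (f (s @ [0]) + f (s @ [1])) \<and>
        1/2 * norm (f (s @ [0]) - f (s @ [1])) \<ge> \<delta>)"

section \<open>Dyadic diamonds\<close>

text \<open>The diamond of index \<open>\<alpha>\<close> is glued from copies of earlier diamonds:
  \<open>Upper i\<close>, \<open>Lower i\<close> stand for the copies \<open>(i,+)\<close>, \<open>(i,-)\<close> in a successor step, \<open>Part n\<close> for
  the \<open>n\<close>-th summand in a limit step. A point is the top, the bottom, one of the middle points
  \<open>x\<^sup>i\<close> of the original first diamond, or a point \<open>Inner c p\<close> of a copy \<open>c\<close> different from the top
  and bottom of that copy.\<close>

datatype copy_label = Upper nat | Lower nat | Part nat

datatype dpoint = Top | Bot | Mid nat | Inner copy_label dpoint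

text \<open>\<open>glue c\<close> is the canonical map of the copy \<open>c\<close> into the glued space.\<close>

fun glue :: "copy_label \<Rightarrow> dpoint \<Rightarrow> dpoint" where
  "glue (Upper i) Top = Top"
| "glue (Upper i) Bot = Mid i"
| "glue (Lower i) Top = Mid i"
| "glue (Lower i) Bot = Bot"
| "glue (Part n) Top = Top"
| "glue (Part n) Bot = Bot"
| "glue c p = Inner c p"

text \<open>\<open>path_length E u v r\<close>: there is a path from \<open>u\<close> to \<open>v\<close> of total length \<open>r\<close>, where \<open>E u v w\<close>
  means that \<open>u\<close> and \<open>v\<close> are joined by a link of length \<open>w\<close>.\<close>

inductive path_length :: "('p \<Rightarrow> 'p \<Rightarrow> real \<Rightarrow> bool) \<Rightarrow> 'p \<Rightarrow> 'p \<Rightarrow> real \<Rightarrow> bool" for E where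
  "path_length E u u 0"
| "E u v w \<Longrightarrow> path_length E v z r \<Longrightarrow> path_length E u z (w + r)"

definition path_metric :: "('p \<Rightarrow> 'p \<Rightarrow> real \<Rightarrow> bool) \<Rightarrow> 'p \<Rightarrow> 'p \<Rightarrow> real" where
  "path_metric E u v = Inf {r. path_length E u v r}"

record diamond =
  points :: "dpoint set"
  ddist :: "dpoint \<Rightarrow> dpoint \<Rightarrow> real"
  active :: "dpoint set set"

definition glue_link ::
  "copy_label set \<Rightarrow> (copy_label \<Rightarrow> diamond) \<Rightarrow> real \<Rightarrow> dpoint \<Rightarrow> dpoint \<Rightarrow> real \<Rightarrow> bool" where
  "glue_link C M r u v w \<longleftrightarrow> (\<exists>c\<in>C. \<exists>p\<in>points (M c). \<exists>q\<in>points (M c).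
     u = glue c p \<and> v = glue c q \<and> w = r * ddist (M c) p q)"

definition two_subsets :: "'p set \<Rightarrow> 'p set set" where
  "two_subsets S = {P. P \<subseteq> S \<and> card P = 2}"

definition original_D1 :: "dpoint set" where
  "original_D1 = {Top, Bot, Mid 0, Mid 1}"

definition diamond_zero :: diamond where
  "diamond_zero = \<lparr>points = {Top, Bot}, ddist = (\<lambda>u v. if u = v then 0 else 1),
     active = {{Top, Bot}}\<rparr>"

definition diamond_succ :: "diamond \<Rightarrow> diamond" where
  "diamond_succ M = (let C = {Upper 0, Upper 1, Lower 0, Lower 1} in
     \<lparr>points = original_D1 \<union> (\<Union>c\<in>C. glue c ` points M),
      ddist = path_metric (glue_link C (\<lambda>_. M) (1/2)),
      active = two_subsets original_D1 \<union> (\<Union>c\<in>C. (\<lambda>P. glue c ` P) ` active M)\<rparr>)"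

definition diamond_limit :: "(nat \<Rightarrow> diamond) \<Rightarrow> diamond" where
  "diamond_limit M =
     \<lparr>points = (\<Union>n. glue (Part n) ` points (M n)),
      ddist = path_metric (glue_link (range Part) (\<lambda>c. case c of Part n \<Rightarrow> M n) 1),
      active = (\<Union>n. (\<lambda>P. glue (Part n) ` P) ` active (M n))\<rparr>"

text \<open>The general successor step applied to \<open>diamond_zero\<close> yields the first diamond.\<close>

definition dyadic_diamond :: "(omega1 \<Rightarrow> nat \<Rightarrow> omega1) \<Rightarrow> omega1 \<Rightarrow> diamond" where
  "dyadic_diamond \<beta> = ord_rec \<beta> diamond_zero diamond_succ diamond_limit"

lemma dyadic_diamond_0: "dyadic_diamond \<beta> 0 = diamond_zero"
  by (simp add: dyadic_diamond_def ord_rec_0)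

lemma dyadic_diamond_osucc:
  "dyadic_diamond \<beta> (osucc \<alpha>) = diamond_succ (dyadic_diamond \<beta> \<alpha>)"
  by (simp add: dyadic_diamond_def ord_rec_osucc)

lemma dyadic_diamond_limit:
  "limit_enumeration \<beta> \<Longrightarrow> limit_ordinal \<alpha> \<Longrightarrow>
     dyadic_diamond \<beta> \<alpha> = diamond_limit (\<lambda>n. dyadic_diamond \<beta> (\<beta> \<alpha> n))"
  by (simp add: dyadic_diamond_def ord_rec_limit)

section \<open>Embeddings\<close>

definition sub_Lipschitz_embeds :: "diamond \<Rightarrow> 'a::real_normed_vector itself \<Rightarrow> bool" where
  "sub_Lipschitz_embeds D X \<longleftrightarrow>
     (\<exists>A>0. \<exists>B>0. \<exists>f :: dpoint \<Rightarrow> 'a. \<forall>u v. {u, v} \<in> active D \<longrightarrow>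
        A * ddist D u v \<le> norm (f u - f v) \<and> norm (f u - f v) \<le> B * ddist D u v)"

definition bi_Lipschitz_embeds :: "'b::metric_space itself \<Rightarrow> 'a::metric_space itself \<Rightarrow> bool" where
  "bi_Lipschitz_embeds Y X \<longleftrightarrow>
     (\<exists>A>0. \<exists>B>0. \<exists>f :: 'b \<Rightarrow> 'a. \<forall>u v.
        A * dist u v \<le> dist (f u) (f v) \<and> dist (f u) (f v) \<le> B * dist u v)"

end

theory Submission
  imports Defs
begin

text \<open>Trees and diamonds are translated into each other by difference quotients.

  Given vectors \<open>x\<close> indexed by a tree of index \<open>\<alpha>\<close>, \<open>diamond_map x\<close> sends the bottom of the
  diamond to \<open>0\<close>, the top to the root \<open>x []\<close>, and the two middle points to \<open>x [0] / 2\<close> and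
  \<open>x [1] / 2\<close>. Since the root is the mean of its two successors, the four sides of this
  parallelogram are \<open>x [0] / 2\<close> and \<open>x [1] / 2\<close>, each occurring twice, and the construction is
  repeated, at half the scale, in each of the four copies of the previous diamond; at limit stages
  all summands share their top and bottom, as the tree has the same vector at a node with infinitely
  many successors and at these successors. If \<open>x\<close> is bounded by \<open>B\<close>, the map is
  \<open>B\<close>-Lipschitz (\<open>diamond_map_Lipschitz\<close>). If the
  norms \<open>\<parallel>x s\<parallel>\<close> and the half distances of siblings are at least \<open>A\<close>, it expands active pairs by at
  least \<open>A\<close> (\<open>diamond_map_active_lower\<close>). A tree in the unit ball acquires the lower bound on its
  norms when it is translated by a vector of norm \<open>2\<close>.

  Conversely, let \<open>f\<close> satisfy the two inequalities on active pairs, and give a copy of a diamond the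
  vector \<open>f t - f b\<close>, where \<open>t\<close> and \<open>b\<close> are its top and bottom, divided by the scale of the copy.
  The vector at a node is the mean of the vectors of the upper and the lower copy through
  either of the two middle points. As these middle points have images at distance at least \<open>A\<close> (in
  the scale of the copy), for one of them the two vectors are at distance at least \<open>2 A\<close>
  (\<open>midpoint_split\<close>). Choosing this middle point at each node gives a tree
  (\<open>tree_from_sub_Lipschitz_map\<close>). To apply this in a copy, one has to know that the copies are
  scaled isometrically on active pairs. Here real-valued trees serve as test functions:
  the distance of an active pair in a diamond is attained by \<open>diamond_map x\<close> for some tree \<open>x\<close> of
  reals in \<open>[-1, 1]\<close>, and such a tree on a copy extends to the whole tree
  (\<open>ddist_copy_active\<close>).

  Sub-Lipschitz embeddability passes from \<open>Y\<close> to \<open>X\<close> by composition, so the first assertion yields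
  the inequality of the indices. For the Infinite Tree Property, a bi-Lipschitz map \<open>g\<close>
  composed with \<open>diamond_map y\<close>, for an infinite tree \<open>y\<close> in \<open>Y\<close>, has at all scales the bounds from which the converse construction
  starts (\<open>infinite_tree_property_from_dilations\<close>).\<close>

section \<open>Ordinals, copies and trees\<close>

lemma omega1_cases [case_names zero succ limit]:
  obtains "\<alpha> = 0" | \<gamma> where "\<alpha> = osucc \<gamma>" | "limit_ordinal \<alpha>"
  unfolding limit_ordinal_def by blast

definition binary_labels :: "copy_label set" where
  "binary_labels = {Upper 0, Upper 1, Lower 0, Lower 1}"

text \<open>The relation says that the diamond of index \<open>\<alpha>\<close> contains a copy labelled \<open>c\<close> of the diamond of
  index \<open>\<gamma>\<close>. It treats the successor and the limit step of the definitions at once, and it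
  decreases the ordinal, so that most proofs below are inductions along it.\<close>

definition copy_of ::
  "(omega1 \<Rightarrow> nat \<Rightarrow> omega1) \<Rightarrow> omega1 \<Rightarrow> copy_label \<Rightarrow> omega1 \<Rightarrow> bool" where
  "copy_of \<beta> \<alpha> c \<gamma> \<longleftrightarrow> \<alpha> = osucc \<gamma> \<and> c \<in> binary_labels \<or>
     limit_ordinal \<alpha> \<and> (\<exists>n. c = Part n \<and> \<gamma> = \<beta> \<alpha> n)"

text \<open>The subtree whose vectors are the difference quotients on a given copy. The upper copy at the
  middle point \<open>i\<close> belongs to the subtree \<open>1 - i\<close>: the side from \<open>x [i] / 2\<close> to the mean of
  \<open>x [0]\<close> and \<open>x [1]\<close> is half of the other successor.\<close>

fun child :: "copy_label \<Rightarrow> nat" where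
  "child (Upper i) = 1 - i"
| "child (Lower i) = i"
| "child (Part n) = n"

fun copy_scale :: "copy_label \<Rightarrow> real" where
  "copy_scale (Part n) = 1"
| "copy_scale _ = 1/2"

lemma copy_scale_pos: "0 < copy_scale c"
  by (cases c) auto

lemma copy_scale_binary: "c \<in> binary_labels \<Longrightarrow> copy_scale c = 1/2"
  by (auto simp: binary_labels_def)

lemma copy_of_osucc: "copy_of \<beta> (osucc \<gamma>) c \<gamma>' \<longleftrightarrow> c \<in> binary_labels \<and> \<gamma>' = \<gamma>"
  by (auto simp: copy_of_def osucc_inject limit_ordinal_def)

lemma copy_of_limit:
  "limit_ordinal \<alpha> \<Longrightarrow> copy_of \<beta> \<alpha> c \<gamma> \<longleftrightarrow> (\<exists>n. c = Part n \<and> \<gamma> = \<beta> \<alpha> n)"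
  by (auto simp: copy_of_def limit_ordinal_def)

lemma copy_of_nonzero: "copy_of \<beta> \<alpha> c \<gamma> \<Longrightarrow> \<alpha> \<noteq> 0"
  by (auto simp: copy_of_def osucc_neq_0 limit_ordinal_def)

lemma copy_of_less:
  assumes "limit_enumeration \<beta>" "copy_of \<beta> \<alpha> c \<gamma>"
  shows "\<gamma> < \<alpha>"
  using assms unfolding copy_of_def limit_enumeration_def
  by (metis less_osucc lessThan_iff rangeI)

lemma Nil_in_tree: "limit_enumeration \<beta> \<Longrightarrow> [] \<in> tree \<beta> \<alpha>"
  by (cases \<alpha> rule: omega1_cases) (auto simp: tree_0 tree_osucc tree_limit)

lemma successors_osucc:
  assumes "limit_enumeration \<beta>"
  shows "successors (tree \<beta> (osucc \<gamma>)) [] = {0, 1}"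
    and "i \<in> {0, 1} \<Longrightarrow>
      successors (tree \<beta> (osucc \<gamma>)) (i # s) = successors (tree \<beta> \<gamma>) s"
  using Nil_in_tree[OF assms, of \<gamma>] by (auto simp: successors_def tree_osucc)

lemma successors_limit:
  assumes "limit_enumeration \<beta>" "limit_ordinal \<alpha>"
  shows "successors (tree \<beta> \<alpha>) [] = UNIV"
    and "successors (tree \<beta> \<alpha>) (n # s) = successors (tree \<beta> (\<beta> \<alpha> n)) s"
  using Nil_in_tree[OF assms(1)] by (auto simp: successors_def tree_limit assms)

lemma delta_tree_0: "delta_tree \<beta> \<delta> 0 x"
  by (auto simp: delta_tree_def tree_0 successors_def)

lemma norm_midpoint_diff:
  fixes x a b :: "'a::real_normed_vector"
  assumes "x = (1/2) *\<^sub>R (a + b)"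
  shows "norm (a - x) = 1/2 * norm (a - b)" "norm (b - x) = 1/2 * norm (a - b)"
proof -
  have "a - x = (1/2) *\<^sub>R (a - b)" "b - x = - ((1/2) *\<^sub>R (a - b))"
    using assms by (simp_all add: algebra_simps flip: scaleR_left_distrib)
  then show "norm (a - x) = 1/2 * norm (a - b)" "norm (b - x) = 1/2 * norm (a - b)"
    by simp_all
qed

text \<open>The equality of the two half distances follows from the midpoint identity, so only the latter
  has to be checked.\<close>

lemma delta_tree_iff:
  "delta_tree \<beta> \<delta> \<alpha> x \<longleftrightarrow> (\<forall>s \<in> tree \<beta> \<alpha>.
     (successors (tree \<beta> \<alpha>) s = {0, 1} \<longrightarrow>
        x s = (1/2) *\<^sub>R (x (s @ [0]) + x (s @ [1])) \<and>
        \<delta> \<le> 1/2 * norm (x (s @ [0]) - x (s @ [1]))) \<and>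
     (infinite (successors (tree \<beta> \<alpha>) s) \<longrightarrow> (\<forall>n. x s = x (s @ [n]))))"
proof -
  have "x s = (1/2) *\<^sub>R (x (s @ [0]) + x (s @ [1])) \<and>
      norm (x (s @ [0]) - x s) = norm (x (s @ [1]) - x s) \<and>
      norm (x (s @ [1]) - x s) = 1/2 * norm (x (s @ [0]) - x (s @ [1])) \<and>
      1/2 * norm (x (s @ [0]) - x (s @ [1])) \<ge> \<delta> \<longleftrightarrow>
      x s = (1/2) *\<^sub>R (x (s @ [0]) + x (s @ [1])) \<and>
        \<delta> \<le> 1/2 * norm (x (s @ [0]) - x (s @ [1]))" for s
    using norm_midpoint_diff[of "x s" "x (s @ [0])" "x (s @ [1])"] by metis
  then show ?thesis unfolding delta_tree_def by presburger
qed

lemma delta_tree_osucc: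
  assumes "limit_enumeration \<beta>"
  shows "delta_tree \<beta> \<delta> (osucc \<gamma>) x \<longleftrightarrow>
    x [] = (1/2) *\<^sub>R (x [0] + x [1]) \<and> \<delta> \<le> 1/2 * norm (x [0] - x [1]) \<and>
    delta_tree \<beta> \<delta> \<gamma> (\<lambda>s. x (0 # s)) \<and> delta_tree \<beta> \<delta> \<gamma> (\<lambda>s. x (1 # s))"
proof -
  have ball: "(\<forall>s\<in>tree \<beta> (osucc \<gamma>). P s) \<longleftrightarrow>
      P [] \<and> (\<forall>s\<in>tree \<beta> \<gamma>. P (0 # s)) \<and> (\<forall>s\<in>tree \<beta> \<gamma>. P (1 # s))" for P
    unfolding tree_osucc by blast
  show ?thesis
    unfolding delta_tree_iff ball successors_osucc(1)[OF assms]
      successors_osucc(2)[OF assms insertI1] successors_osucc(2)[OF assms insertI2[OF singletonI]]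
    by simp
qed

lemma delta_tree_limit:
  assumes "limit_enumeration \<beta>" "limit_ordinal \<alpha>"
  shows "delta_tree \<beta> \<delta> \<alpha> x \<longleftrightarrow>
    (\<forall>n. x [] = x [n] \<and> delta_tree \<beta> \<delta> (\<beta> \<alpha> n) (\<lambda>s. x (n # s)))"
proof -
  have ball: "(\<forall>s\<in>tree \<beta> \<alpha>. P s) \<longleftrightarrow> P [] \<and> (\<forall>n. \<forall>s\<in>tree \<beta> (\<beta> \<alpha> n). P (n # s))" for P
    unfolding tree_limit[OF assms] by blast
  have "(UNIV :: nat set) \<noteq> {0, 1}"
    by (metis finite.emptyI finite.insertI infinite_UNIV_nat)
  then show ?thesis
    unfolding delta_tree_iff ball successors_limit[OF assms]
    by (simp add: all_conj_distrib)
qed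

lemma child_binary: "c \<in> binary_labels \<Longrightarrow> child c \<in> {0, 1}"
  by (auto simp: binary_labels_def)

lemma delta_tree_copy:
  assumes "limit_enumeration \<beta>" "copy_of \<beta> \<alpha> c \<gamma>" "delta_tree \<beta> \<delta> \<alpha> x"
  shows "delta_tree \<beta> \<delta> \<gamma> (\<lambda>s. x (child c # s))"
  using assms child_binary[of c]
  by (cases \<alpha> rule: omega1_cases)
    (auto simp: copy_of_osucc copy_of_limit delta_tree_osucc delta_tree_limit dest: copy_of_nonzero)

lemma tree_copy:
  assumes "limit_enumeration \<beta>" "copy_of \<beta> \<alpha> c \<gamma>" "s \<in> tree \<beta> \<gamma>"
  shows "child c # s \<in> tree \<beta> \<alpha>"
proof (cases \<alpha> rule: omega1_cases)
  case (succ \<gamma>')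
  then show ?thesis
    using assms child_binary[of c] by (auto simp: copy_of_osucc tree_osucc)
next
  case limit
  then obtain n where "c = Part n" "\<gamma> = \<beta> \<alpha> n" using assms(2) by (auto simp: copy_of_limit)
  then show ?thesis using assms(3) unfolding tree_limit[OF assms(1) limit] by auto
qed (use copy_of_nonzero[OF assms(2)] in simp)

lemma delta_tree_affine:
  fixes x :: "nat list \<Rightarrow> 'a::real_normed_vector"
  assumes x: "delta_tree \<beta> \<delta> \<alpha> x" and "0 < r"
  shows "delta_tree \<beta> (r * \<delta>) \<alpha> (\<lambda>s. v + r *\<^sub>R x s)"
proof -
  have mid: "v + r *\<^sub>R a = (1/2) *\<^sub>R ((v + r *\<^sub>R b) + (v + r *\<^sub>R c))"
    if "a = (1/2) *\<^sub>R (b + c)" for a b c :: 'a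
    using scaleR_half_double[of v] unfolding that by (simp add: scaleR_add_right)
  have dist: "r * \<delta> \<le> 1/2 * norm ((v + r *\<^sub>R b) - (v + r *\<^sub>R c))"
    if "\<delta> \<le> 1/2 * norm (b - c)" for b c :: 'a
    using mult_left_mono[OF that, of r] \<open>0 < r\<close> by (simp flip: scaleR_diff_right)
  show ?thesis
    unfolding delta_tree_iff
  proof (intro ballI conjI impI allI)
    fix s n assume s: "s \<in> tree \<beta> \<alpha>" "infinite (successors (tree \<beta> \<alpha>) s)"
    then have "x s = x (s @ [n])" using x unfolding delta_tree_iff by blast
    then show "v + r *\<^sub>R x s = v + r *\<^sub>R x (s @ [n])" by simp
  qed (use x in \<open>auto simp only: delta_tree_iff intro!: mid dist\<close>)
qed

lemma delta_tree_const: "delta_tree \<beta> 0 \<alpha> (\<lambda>_. v)"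
  using scaleR_half_double[of v] by (simp add: delta_tree_iff scaleR_add_right)

text \<open>An ordinal below a limit \<open>\<alpha>\<close> occurs in the enumeration attached to \<open>\<alpha>\<close>, and an ordinal below
  \<open>osucc \<alpha>'\<close> is at most \<open>\<alpha>'\<close>; in both cases a subtree of the given tree is a tree of the required
  or of an intermediate index.\<close>

lemma ball_contains_tree_mono:
  fixes X :: "'a::real_normed_vector itself"
  assumes "limit_enumeration \<beta>" "ball_contains_tree \<beta> X \<delta> \<alpha>" "\<gamma> \<le> \<alpha>"
  shows "ball_contains_tree \<beta> X \<delta> \<gamma>"
  using assms(2,3)
proof (induction \<alpha> rule: less_induct)
  case (less \<alpha>)
  have sub: "ball_contains_tree \<beta> X \<delta> \<gamma>'" if "copy_of \<beta> \<alpha> c \<gamma>'" for c \<gamma>'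
  proof -
    from less.prems(1) obtain x :: "nat list \<Rightarrow> 'a"
      where x: "delta_tree \<beta> \<delta> \<alpha> x" "x ` tree \<beta> \<alpha> \<subseteq> cball 0 1"
      unfolding ball_contains_tree_def by blast
    have "(\<lambda>s. x (child c # s)) ` tree \<beta> \<gamma>' \<subseteq> cball 0 1"
      using x(2) tree_copy[OF assms(1) that] by (simp add: image_subset_iff)
    then show ?thesis
      unfolding ball_contains_tree_def
      by (intro exI[of _ "\<lambda>s. x (child c # s)"] conjI delta_tree_copy[OF assms(1) that x(1)])
  qed
  show ?case
  proof (cases "\<gamma> = \<alpha>")
    case True
    then show ?thesis using less.prems by simp
  next
    case False
    then have "\<gamma> < \<alpha>" using less.prems by simp
    then show ?thesis
    proof (cases \<alpha> rule: omega1_cases)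
      case zero
      then show ?thesis using \<open>\<gamma> < \<alpha>\<close> zero_le_omega1[of \<gamma>] leD by blast
    next
      case (succ \<alpha>')
      then have "copy_of \<beta> \<alpha> (Lower 0) \<alpha>'" by (simp add: succ copy_of_osucc binary_labels_def)
      moreover have "\<gamma> \<le> \<alpha>'"
        using \<open>\<gamma> < \<alpha>\<close> osucc_le_iff[of \<alpha>' \<gamma>] unfolding succ by (meson not_le)
      moreover have "\<alpha>' < \<alpha>" by (simp add: succ less_osucc)
      ultimately show ?thesis using less.IH sub by blast
    next
      case limit
      then have "\<gamma> \<in> range (\<beta> \<alpha>)"
        using \<open>\<gamma> < \<alpha>\<close> assms(1) by (simp add: limit_enumeration_def)
      then obtain n where "\<gamma> = \<beta> \<alpha> n" by blast
      then have "copy_of \<beta> \<alpha> (Part n) \<gamma>" using limit by (simp add: copy_of_limit)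
      then show ?thesis by (rule sub)
    qed
  qed
qed

text \<open>By monotonicity in the ordinal, the infimum that defines \<open>DT_delta\<close> exceeds \<open>\<alpha>\<close> as soon as there
  is a tree of index \<open>\<alpha>\<close> itself.\<close>

lemma Ord_less_DT_iff:
  assumes "limit_enumeration \<beta>"
  shows "Ord \<alpha> < DT \<beta> X \<longleftrightarrow> (\<exists>\<delta>>0. ball_contains_tree \<beta> X \<delta> \<alpha>)"
proof -
  have "Ord \<alpha> < DT_delta \<beta> X \<delta> \<longleftrightarrow> ball_contains_tree \<beta> X \<delta> \<alpha>" for \<delta>
  proof
    assume "Ord \<alpha> < DT_delta \<beta> X \<delta>"
    then show "ball_contains_tree \<beta> X \<delta> \<alpha>"
      unfolding DT_delta_def
      using Inf_lower[of "Ord \<alpha>" "Ord ` {\<gamma>. \<not> ball_contains_tree \<beta> X \<delta> \<gamma>}"] leD by blast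
  next
    assume *: "ball_contains_tree \<beta> X \<delta> \<alpha>"
    have gt: "Ord \<alpha> < y" if "y \<in> Ord ` {\<gamma>. \<not> ball_contains_tree \<beta> X \<delta> \<gamma>}" for y
    proof -
      from that obtain \<gamma> where \<gamma>: "y = Ord \<gamma>" "\<not> ball_contains_tree \<beta> X \<delta> \<gamma>" by blast
      then have "\<not> \<gamma> \<le> \<alpha>" using ball_contains_tree_mono[OF assms *] by blast
      then show ?thesis using \<gamma> by (simp add: less_ext_ord_def)
    qed
    let ?A = "Ord ` {\<gamma>. \<not> ball_contains_tree \<beta> X \<delta> \<gamma>}"
    have "Inf ?A = Infty \<or> Inf ?A \<in> ?A"
      unfolding Inf_ext_ord_def using LeastI[of "\<lambda>x. x \<in> ?A"] by auto
    then show "Ord \<alpha> < DT_delta \<beta> X \<delta>"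
      unfolding DT_delta_def using gt by (auto simp: less_ext_ord_def)
  qed
  then show ?thesis by (auto simp: DT_def less_SUP_iff)
qed

section \<open>The path metric of the diamonds\<close>

lemma path_length_nonneg:
  assumes "path_length E u v r" "\<And>u v w. E u v w \<Longrightarrow> 0 \<le> w"
  shows "0 \<le> r"
  using assms(1) by induction (auto intro: add_nonneg_nonneg assms(2))

lemma path_length_trans:
  "path_length E u v r \<Longrightarrow> path_length E v z r' \<Longrightarrow> path_length E u z (r + r')"
  by (induction rule: path_length.induct) (auto simp: add.assoc intro: path_length.intros)

lemma path_length_link: "E u v w \<Longrightarrow> path_length E u v w"
  using path_length.intros(2)[OF _ path_length.intros(1)] by fastforce

lemma path_length_sym:
  assumes "path_length E u v r" "\<And>u v w. E u v w \<Longrightarrow> E v u w"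
  shows "path_length E v u r"
  using assms(1)
proof induction
  case (2 u v w z r)
  have "path_length E v u w" by (rule path_length_link) (rule assms(2)[OF 2(1)])
  from path_length_trans[OF 2(3) this] show ?case by (simp add: add.commute)
qed (rule path_length.intros)

lemma path_metric_le:
  assumes "path_length E u v r" "\<And>u v w. E u v w \<Longrightarrow> 0 \<le> w"
  shows "path_metric E u v \<le> r"
  unfolding path_metric_def
  by (rule cInf_lower) (use assms path_length_nonneg[of E] in \<open>auto intro!: bdd_belowI[of _ 0]\<close>)

lemma path_metric_sym:
  assumes "\<And>u v w. E u v w \<Longrightarrow> E v u w"
  shows "path_metric E u v = path_metric E v u"
proof -
  have "{r. path_length E u v r} = {r. path_length E v u r}"
    using path_length_sym[of E] assms by blast
  then show ?thesis by (simp add: path_metric_def)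
qed

text \<open>The lower bounds for distances of active pairs are obtained from this: a path exists, so that the
  infimum is over a nonempty set, and no path can be shorter than what \<open>g\<close> detects.\<close>

lemma Lipschitz_path_metric:
  fixes g :: "'p \<Rightarrow> 'a::real_normed_vector"
  assumes link: "\<And>u v w. E u v w \<Longrightarrow> norm (g u - g v) \<le> B * w"
    and "0 < B" and "\<exists>r. path_length E u v r"
  shows "norm (g u - g v) \<le> B * path_metric E u v"
proof -
  have "norm (g u - g v) \<le> B * r" if "path_length E u v r" for r
    using that
  proof induction
    case (2 u v w z r)
    have "norm (g u - g z) \<le> norm (g u - g v) + norm (g v - g z)"
      using norm_triangle_ineq[of "g u - g v" "g v - g z"] by simp
    also have "\<dots> \<le> B * (w + r)" using link[OF 2(1)] 2(3) by (simp add: distrib_left)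
    finally show ?case .
  qed simp
  then have "norm (g u - g v) / B \<le> path_metric E u v"
    unfolding path_metric_def using assms
    by (intro cInf_greatest) (auto simp: divide_le_eq mult.commute)
  then show ?thesis using \<open>0 < B\<close> by (simp add: divide_le_eq mult.commute)
qed

text \<open>The links of the successor and of the limit construction in a common form.\<close>

definition diamond_link ::
  "(omega1 \<Rightarrow> nat \<Rightarrow> omega1) \<Rightarrow> omega1 \<Rightarrow> dpoint \<Rightarrow> dpoint \<Rightarrow> real \<Rightarrow> bool" where
  "diamond_link \<beta> \<alpha> u v w \<longleftrightarrow> (\<exists>c \<gamma> p q. copy_of \<beta> \<alpha> c \<gamma> \<and>
     p \<in> points (dyadic_diamond \<beta> \<gamma>) \<and> q \<in> points (dyadic_diamond \<beta> \<gamma>) \<and>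
     u = glue c p \<and> v = glue c q \<and> w = copy_scale c * ddist (dyadic_diamond \<beta> \<gamma>) p q)"

lemma ddist_eq_path_metric:
  assumes "limit_enumeration \<beta>" "\<alpha> \<noteq> 0"
  shows "ddist (dyadic_diamond \<beta> \<alpha>) = path_metric (diamond_link \<beta> \<alpha>)"
proof (cases \<alpha> rule: omega1_cases)
  case (succ \<gamma>)
  have "glue_link binary_labels (\<lambda>_. dyadic_diamond \<beta> \<gamma>) (1/2) = diamond_link \<beta> \<alpha>"
    unfolding glue_link_def diamond_link_def succ copy_of_osucc fun_eq_iff
    using copy_scale_binary by (fastforce simp: Bex_def)
  then show ?thesis
    using succ by (simp add: dyadic_diamond_osucc diamond_succ_def Let_def binary_labels_def)
next
  case limit
  have "glue_link (range Part) (\<lambda>c. case c of Part n \<Rightarrow> dyadic_diamond \<beta> (\<beta> \<alpha> n)) 1 u v w \<longleftrightarrow>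
      diamond_link \<beta> \<alpha> u v w" for u v w
  proof
    assume "diamond_link \<beta> \<alpha> u v w"
    then show "glue_link (range Part) (\<lambda>c. case c of Part n \<Rightarrow> dyadic_diamond \<beta> (\<beta> \<alpha> n)) 1 u v w"
      unfolding glue_link_def diamond_link_def copy_of_limit[OF limit] by fastforce
  next
    assume "glue_link (range Part) (\<lambda>c. case c of Part n \<Rightarrow> dyadic_diamond \<beta> (\<beta> \<alpha> n)) 1 u v w"
    then obtain n p q where "p \<in> points (dyadic_diamond \<beta> (\<beta> \<alpha> n))"
      "q \<in> points (dyadic_diamond \<beta> (\<beta> \<alpha> n))" "u = glue (Part n) p" "v = glue (Part n) q"
      "w = copy_scale (Part n) * ddist (dyadic_diamond \<beta> (\<beta> \<alpha> n)) p q"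
      unfolding glue_link_def by auto
    then show "diamond_link \<beta> \<alpha> u v w"
      unfolding diamond_link_def copy_of_limit[OF limit] by blast
  qed
  then have "glue_link (range Part) (\<lambda>c. case c of Part n \<Rightarrow> dyadic_diamond \<beta> (\<beta> \<alpha> n)) 1
      = diamond_link \<beta> \<alpha>" by blast
  then show ?thesis
    using limit assms by (simp add: dyadic_diamond_limit diamond_limit_def)
qed (use assms in simp)

lemma Top_Bot_in_points:
  assumes "limit_enumeration \<beta>"
  shows "Top \<in> points (dyadic_diamond \<beta> \<alpha>) \<and> Bot \<in> points (dyadic_diamond \<beta> \<alpha>)"
proof (induction \<alpha> rule: less_induct)
  case (less \<alpha>)
  show ?case
  proof (cases \<alpha> rule: omega1_cases)
    case limit
    then have "\<beta> \<alpha> 0 < \<alpha>" using copy_of_less[OF assms] copy_of_limit by blast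
    with less have "Top \<in> points (dyadic_diamond \<beta> (\<beta> \<alpha> 0))"
      "Bot \<in> points (dyadic_diamond \<beta> (\<beta> \<alpha> 0))" by auto
    then have "glue (Part 0) Top \<in> points (dyadic_diamond \<beta> \<alpha>)"
      "glue (Part 0) Bot \<in> points (dyadic_diamond \<beta> \<alpha>)"
      unfolding dyadic_diamond_limit[OF assms limit] diamond_limit_def by (simp_all del: glue.simps) blast+
    then show ?thesis by simp
  qed (simp_all add: dyadic_diamond_0 diamond_zero_def dyadic_diamond_osucc diamond_succ_def Let_def
      original_D1_def)
qed

lemma points_iff:
  assumes "limit_enumeration \<beta>" "\<alpha> \<noteq> 0"
  shows "u \<in> points (dyadic_diamond \<beta> \<alpha>) \<longleftrightarrow>
    (\<exists>c \<gamma> p. copy_of \<beta> \<alpha> c \<gamma> \<and> p \<in> points (dyadic_diamond \<beta> \<gamma>) \<and> u = glue c p)"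
proof (cases \<alpha> rule: omega1_cases)
  case (succ \<gamma>)
  have "original_D1 \<subseteq> (\<Union>c\<in>binary_labels. glue c ` points (dyadic_diamond \<beta> \<gamma>))"
  proof
    fix u assume "u \<in> original_D1"
    then have "u \<in> {glue (Upper 0) Top, glue (Lower 0) Bot, glue (Upper 0) Bot, glue (Upper 1) Bot}"
      by (auto simp: original_D1_def)
    then show "u \<in> (\<Union>c\<in>binary_labels. glue c ` points (dyadic_diamond \<beta> \<gamma>))"
      using Top_Bot_in_points[OF assms(1), of \<gamma>]
      unfolding binary_labels_def by blast
  qed
  then have "points (dyadic_diamond \<beta> \<alpha>) =
      (\<Union>c\<in>binary_labels. glue c ` points (dyadic_diamond \<beta> \<gamma>))"
    unfolding succ dyadic_diamond_osucc diamond_succ_def Let_def binary_labels_def[symmetric]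
    by (simp add: Un_absorb1)
  then show ?thesis by (auto simp: succ copy_of_osucc)
next
  case limit
  then show ?thesis
    unfolding dyadic_diamond_limit[OF assms(1) limit] diamond_limit_def copy_of_limit[OF limit]
    by auto
qed (use assms in simp)

lemma original_D1_subset_points:
  "original_D1 \<subseteq> points (dyadic_diamond \<beta> (osucc \<gamma>))"
  by (auto simp: dyadic_diamond_osucc diamond_succ_def Let_def)

lemma diamond_link_copy:
  assumes "copy_of \<beta> \<alpha> c \<gamma>" "p \<in> points (dyadic_diamond \<beta> \<gamma>)" "q \<in> points (dyadic_diamond \<beta> \<gamma>)"
  shows "diamond_link \<beta> \<alpha> (glue c p) (glue c q) (copy_scale c * ddist (dyadic_diamond \<beta> \<gamma>) p q)"
  using assms unfolding diamond_link_def by blast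

lemma diamond_linkE:
  assumes "diamond_link \<beta> \<alpha> u v w"
  obtains c \<gamma> p q where "copy_of \<beta> \<alpha> c \<gamma>"
    "p \<in> points (dyadic_diamond \<beta> \<gamma>)" "q \<in> points (dyadic_diamond \<beta> \<gamma>)"
    "u = glue c p" "v = glue c q" "w = copy_scale c * ddist (dyadic_diamond \<beta> \<gamma>) p q"
  using assms unfolding diamond_link_def by blast

text \<open>All copies meet the top or one of the two middle points, and the middle points are joined to
  the top; so the set of path lengths defining a distance is never empty.\<close>

lemma diamond_connected_to_Top:
  assumes "limit_enumeration \<beta>" "\<alpha> \<noteq> 0" "u \<in> points (dyadic_diamond \<beta> \<alpha>)"
  shows "\<exists>r. path_length (diamond_link \<beta> \<alpha>) u Top r"
proof -
  obtain c \<gamma> p where c: "copy_of \<beta> \<alpha> c \<gamma>" "p \<in> points (dyadic_diamond \<beta> \<gamma>)" "u = glue c p"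
    using assms points_iff by blast
  note TB = Top_Bot_in_points[OF assms(1), of \<gamma>]
  have 1: "\<exists>r. path_length (diamond_link \<beta> \<alpha>) u (glue c Top) r"
    unfolding c(3) using path_length_link[of "diamond_link \<beta> \<alpha>", OF diamond_link_copy[OF c(1,2)]] TB by blast
  have "\<exists>r. path_length (diamond_link \<beta> \<alpha>) (glue c Top) Top r"
  proof (cases c)
    \<comment> \<open>The top of a lower copy is a middle point, which is also the bottom of an upper copy.\<close>
    case (Lower i)
    then have "copy_of \<beta> \<alpha> (Upper i) \<gamma>" using c(1) by (auto simp: copy_of_def binary_labels_def)
    from path_length_link[of "diamond_link \<beta> \<alpha>", OF diamond_link_copy[OF this, of Bot Top]] TB
    show ?thesis by (auto simp: Lower)
  qed (auto intro: path_length.intros)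
  with 1 show ?thesis using path_length_trans[of "diamond_link \<beta> \<alpha>"] by meson
qed

text \<open>Both properties are needed at all smaller indices before the path metric at index \<open>\<alpha>\<close> can be
  estimated, since they make the links symmetric and nonnegative.\<close>

lemma ddist_sym_nonneg:
  assumes "limit_enumeration \<beta>" "p \<in> points (dyadic_diamond \<beta> \<alpha>)" "q \<in> points (dyadic_diamond \<beta> \<alpha>)"
  shows "0 \<le> ddist (dyadic_diamond \<beta> \<alpha>) p q \<and>
    ddist (dyadic_diamond \<beta> \<alpha>) p q = ddist (dyadic_diamond \<beta> \<alpha>) q p"
  using assms(2,3)
proof (induction \<alpha> arbitrary: p q rule: less_induct)
  case (less \<alpha>)
  show ?case
  proof (cases "\<alpha> = 0")
    case True
    then show ?thesis by (auto simp: dyadic_diamond_0 diamond_zero_def)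
  next
    case False
    have link: "diamond_link \<beta> \<alpha> v u w" "0 \<le> w" if "diamond_link \<beta> \<alpha> u v w" for u v w
    proof -
      from that obtain c \<gamma> p q where c: "copy_of \<beta> \<alpha> c \<gamma>"
        and pq: "p \<in> points (dyadic_diamond \<beta> \<gamma>)" "q \<in> points (dyadic_diamond \<beta> \<gamma>)"
        and eq: "u = glue c p" "v = glue c q" "w = copy_scale c * ddist (dyadic_diamond \<beta> \<gamma>) p q"
        by (rule diamond_linkE)
      note IH = less.IH[OF copy_of_less[OF assms(1) c] pq]
      show "0 \<le> w" using IH copy_scale_pos[of c] by (simp add: eq)
      show "diamond_link \<beta> \<alpha> v u w"
        using diamond_link_copy[OF c pq(2,1)] IH by (simp add: eq)
    qed
    obtain r r' where r: "path_length (diamond_link \<beta> \<alpha>) p Top r"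
      and r': "path_length (diamond_link \<beta> \<alpha>) q Top r'"
      using diamond_connected_to_Top[OF assms(1) False] less.prems by blast
    have "path_length (diamond_link \<beta> \<alpha>) p q (r + r')"
      by (rule path_length_trans[OF r path_length_sym[OF r' link(1)]])
    then have "0 \<le> path_metric (diamond_link \<beta> \<alpha>) p q"
      unfolding path_metric_def
      by (intro cInf_greatest) (auto intro: path_length_nonneg[OF _ link(2)])
    then show ?thesis
      unfolding ddist_eq_path_metric[OF assms(1) False]
      using path_metric_sym[of "diamond_link \<beta> \<alpha>", OF link(1)] by blast
  qed
qed

lemma diamond_link_sym_nonneg:
  assumes "limit_enumeration \<beta>" "diamond_link \<beta> \<alpha> u v w"
  shows "diamond_link \<beta> \<alpha> v u w" "0 \<le> w"
proof -
  from assms(2) obtain c \<gamma> p q where c: "copy_of \<beta> \<alpha> c \<gamma>"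
    and pq: "p \<in> points (dyadic_diamond \<beta> \<gamma>)" "q \<in> points (dyadic_diamond \<beta> \<gamma>)"
    and eq: "u = glue c p" "v = glue c q" "w = copy_scale c * ddist (dyadic_diamond \<beta> \<gamma>) p q"
    by (rule diamond_linkE)
  note ddist = ddist_sym_nonneg[OF assms(1) pq]
  show "0 \<le> w" using ddist copy_scale_pos[of c] by (simp add: eq)
  show "diamond_link \<beta> \<alpha> v u w"
    using diamond_link_copy[OF c pq(2,1)] ddist by (simp add: eq)
qed

lemma diamond_connected:
  assumes "limit_enumeration \<beta>" "\<alpha> \<noteq> 0"
    "u \<in> points (dyadic_diamond \<beta> \<alpha>)" "v \<in> points (dyadic_diamond \<beta> \<alpha>)"
  shows "\<exists>r. path_length (diamond_link \<beta> \<alpha>) u v r"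
proof -
  obtain r r' where r: "path_length (diamond_link \<beta> \<alpha>) u Top r"
    and r': "path_length (diamond_link \<beta> \<alpha>) v Top r'"
    using diamond_connected_to_Top[OF assms(1,2)] assms(3,4) by blast
  show ?thesis
    using path_length_trans[OF r path_length_sym[OF r' diamond_link_sym_nonneg(1)[OF assms(1)]]]
    by blast
qed

lemma ddist_le_path:
  assumes "limit_enumeration \<beta>" "\<alpha> \<noteq> 0" "path_length (diamond_link \<beta> \<alpha>) u v r"
  shows "ddist (dyadic_diamond \<beta> \<alpha>) u v \<le> r"
  unfolding ddist_eq_path_metric[OF assms(1,2)]
  by (rule path_metric_le[OF assms(3) diamond_link_sym_nonneg(2)[OF assms(1)]])

lemma ddist_copy_le:
  assumes "limit_enumeration \<beta>" "copy_of \<beta> \<alpha> c \<gamma>"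
    "p \<in> points (dyadic_diamond \<beta> \<gamma>)" "q \<in> points (dyadic_diamond \<beta> \<gamma>)"
  shows "ddist (dyadic_diamond \<beta> \<alpha>) (glue c p) (glue c q) \<le>
    copy_scale c * ddist (dyadic_diamond \<beta> \<gamma>) p q"
  by (rule ddist_le_path[OF assms(1) copy_of_nonzero[OF assms(2)]])
    (rule path_length_link, rule diamond_link_copy[OF assms(2-4)])

lemma ddist_Top_Bot_le:
  assumes "limit_enumeration \<beta>"
  shows "ddist (dyadic_diamond \<beta> \<alpha>) Top Bot \<le> 1"
proof (induction \<alpha> rule: less_induct)
  case (less \<alpha>)
  note TB = Top_Bot_in_points[OF assms]
  show ?case
  proof (cases \<alpha> rule: omega1_cases)
    case zero
    then show ?thesis by (simp add: dyadic_diamond_0 diamond_zero_def)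
  next
    case (succ \<gamma>)
    have "copy_of \<beta> \<alpha> (Upper 0) \<gamma>" "copy_of \<beta> \<alpha> (Lower 0) \<gamma>"
      by (auto simp: succ copy_of_osucc binary_labels_def)
    then have "path_length (diamond_link \<beta> \<alpha>) Top (Mid 0) (1/2 * ddist (dyadic_diamond \<beta> \<gamma>) Top Bot)"
      "path_length (diamond_link \<beta> \<alpha>) (Mid 0) Bot (1/2 * ddist (dyadic_diamond \<beta> \<gamma>) Top Bot)"
      using diamond_link_copy[of \<beta> \<alpha> _ \<gamma> Top Bot] TB[of \<gamma>]
      by (auto intro!: path_length_link; fastforce)+
    from ddist_le_path[OF assms _ path_length_trans[OF this]] less.IH[of \<gamma>] less_osucc[of \<gamma>]
    show ?thesis by (simp add: succ osucc_neq_0)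
  next
    case limit
    then have c: "copy_of \<beta> \<alpha> (Part 0) (\<beta> \<alpha> 0)" by (simp add: copy_of_limit)
    show ?thesis
      using ddist_copy_le[OF assms c, of Top Bot] TB less.IH[OF copy_of_less[OF assms c]] by simp
  qed
qed

lemma ddist_original_le:
  assumes "limit_enumeration \<beta>" "i \<in> {0, 1}"
  shows "ddist (dyadic_diamond \<beta> (osucc \<gamma>)) Top (Mid i) \<le> 1/2"
    and "ddist (dyadic_diamond \<beta> (osucc \<gamma>)) (Mid i) Bot \<le> 1/2"
    and "ddist (dyadic_diamond \<beta> (osucc \<gamma>)) (Mid 0) (Mid 1) \<le> 1"
proof -
  note TB = Top_Bot_in_points[OF assms(1)]
  have c: "copy_of \<beta> (osucc \<gamma>) (Upper j) \<gamma>" "copy_of \<beta> (osucc \<gamma>) (Lower j) \<gamma>" if "j \<in> {0, 1}" for j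
    using that by (auto simp: copy_of_osucc binary_labels_def)
  show "ddist (dyadic_diamond \<beta> (osucc \<gamma>)) Top (Mid i) \<le> 1/2"
    "ddist (dyadic_diamond \<beta> (osucc \<gamma>)) (Mid i) Bot \<le> 1/2"
    using ddist_copy_le[OF assms(1) c(1)[OF assms(2)], of Top Bot]
      ddist_copy_le[OF assms(1) c(2)[OF assms(2)], of Top Bot] TB ddist_Top_Bot_le[OF assms(1), of \<gamma>]
    by auto
  let ?w = "1/2 * ddist (dyadic_diamond \<beta> \<gamma>) Top Bot"
  have link: "diamond_link \<beta> (osucc \<gamma>) Top (Mid j) ?w" if "j \<in> {0, 1}" for j
    using diamond_link_copy[OF c(1)[OF that], of Top Bot] TB by simp
  have "path_length (diamond_link \<beta> (osucc \<gamma>)) (Mid 0) (Mid 1) (?w + ?w)"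
    using link[of 0] link[of 1] diamond_link_sym_nonneg(1)[OF assms(1)]
    by (blast intro: path_length_trans path_length_link)
  from ddist_le_path[OF assms(1) osucc_neq_0 this] ddist_Top_Bot_le[OF assms(1), of \<gamma>]
  show "ddist (dyadic_diamond \<beta> (osucc \<gamma>)) (Mid 0) (Mid 1) \<le> 1" by simp
qed

section \<open>Active pairs\<close>

lemma active_osucc:
  "P \<in> active (dyadic_diamond \<beta> (osucc \<gamma>)) \<longleftrightarrow> P \<in> two_subsets original_D1 \<or>
     (\<exists>c\<in>binary_labels. \<exists>P'\<in>active (dyadic_diamond \<beta> \<gamma>). P = glue c ` P')"
  unfolding dyadic_diamond_osucc diamond_succ_def Let_def binary_labels_def[symmetric]
  by (simp only: diamond.simps Un_iff UN_iff image_iff)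

lemma active_limit:
  assumes "limit_enumeration \<beta>" "limit_ordinal \<alpha>"
  shows "P \<in> active (dyadic_diamond \<beta> \<alpha>) \<longleftrightarrow>
    (\<exists>n. \<exists>P'\<in>active (dyadic_diamond \<beta> (\<beta> \<alpha> n)). P = glue (Part n) ` P')"
  unfolding dyadic_diamond_limit[OF assms] diamond_limit_def
  by (simp only: diamond.simps UN_iff image_iff bex_UNIV)

lemma active_iff:
  assumes "limit_enumeration \<beta>"
  shows "P \<in> active (dyadic_diamond \<beta> \<alpha>) \<longleftrightarrow>
    \<alpha> = 0 \<and> P = {Top, Bot} \<or> (\<exists>\<gamma>. \<alpha> = osucc \<gamma> \<and> P \<in> two_subsets original_D1) \<or>
    (\<exists>c \<gamma> P'. copy_of \<beta> \<alpha> c \<gamma> \<and> P' \<in> active (dyadic_diamond \<beta> \<gamma>) \<and> P = glue c ` P')"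
proof (cases \<alpha> rule: omega1_cases)
  case zero
  then show ?thesis
    using copy_of_nonzero[of \<beta> \<alpha>] osucc_neq_0
    by (metis diamond.select_convs(3) diamond_zero_def dyadic_diamond_0 singleton_iff)
next
  case (succ \<gamma>)
  show ?thesis
    unfolding succ active_osucc copy_of_osucc osucc_inject by (simp add: osucc_neq_0) metis
next
  case limit
  then have "\<alpha> \<noteq> 0" "\<And>\<gamma>. \<alpha> \<noteq> osucc \<gamma>" by (simp_all add: limit_ordinal_def)
  then show ?thesis
    unfolding active_limit[OF assms limit] copy_of_limit[OF limit] by simp metis
qed

lemma activeE:
  assumes "limit_enumeration \<beta>" "P \<in> active (dyadic_diamond \<beta> \<alpha>)"
  obtains (zero) "\<alpha> = 0" "P = {Top, Bot}"
  | (original) \<gamma> where "\<alpha> = osucc \<gamma>" "P \<in> two_subsets original_D1"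
  | (copy) c \<gamma> P' where "copy_of \<beta> \<alpha> c \<gamma>" "P' \<in> active (dyadic_diamond \<beta> \<gamma>)" "P = glue c ` P'"
  using assms(2) unfolding active_iff[OF assms(1), of P] by (elim disjE exE conjE)

lemma active_doubleton:
  assumes "limit_enumeration \<beta>" "P \<in> active (dyadic_diamond \<beta> \<alpha>)"
  shows "\<exists>p\<in>points (dyadic_diamond \<beta> \<alpha>). \<exists>q\<in>points (dyadic_diamond \<beta> \<alpha>). P = {p, q}"
  using assms(2)
proof (induction \<alpha> arbitrary: P rule: less_induct)
  case (less \<alpha>)
  from assms(1) less.prems show ?case
  proof (cases rule: activeE)
    case zero
    then show ?thesis by (auto simp: dyadic_diamond_0 diamond_zero_def)
  next
    case (original \<gamma>)
    then have "P \<subseteq> points (dyadic_diamond \<beta> \<alpha>)" "card P = 2"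
      using original_D1_subset_points[of \<beta> \<gamma>] by (auto simp: two_subsets_def)
    then show ?thesis by (auto simp: card_2_iff)
  next
    case (copy c \<gamma> P')
    obtain p q where pq: "p \<in> points (dyadic_diamond \<beta> \<gamma>)" "q \<in> points (dyadic_diamond \<beta> \<gamma>)"
      and "P' = {p, q}"
      using less.IH[OF copy_of_less[OF assms(1) copy(1)] copy(2)] by blast
    then have "P = {glue c p, glue c q}" by (simp add: copy(3))
    moreover have "glue c p \<in> points (dyadic_diamond \<beta> \<alpha>)" "glue c q \<in> points (dyadic_diamond \<beta> \<alpha>)"
      using copy(1) pq points_iff[OF assms(1) copy_of_nonzero[OF copy(1)]] by blast+
    ultimately show ?thesis by blast
  qed
qed

lemma active_copyI:
  assumes "limit_enumeration \<beta>" "copy_of \<beta> \<alpha> c \<gamma>" "{p, q} \<in> active (dyadic_diamond \<beta> \<gamma>)"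
  shows "{glue c p, glue c q} \<in> active (dyadic_diamond \<beta> \<alpha>)"
proof -
  have "{glue c p, glue c q} = glue c ` {p, q}" by simp
  then show ?thesis using assms(2,3) unfolding active_iff[OF assms(1), of _ \<alpha>] by blast
qed

lemma Top_Bot_active:
  assumes "limit_enumeration \<beta>"
  shows "{Top, Bot} \<in> active (dyadic_diamond \<beta> \<alpha>)"
proof (induction \<alpha> rule: less_induct)
  case (less \<alpha>)
  show ?case
  proof (cases \<alpha> rule: omega1_cases)
    case limit
    then have c: "copy_of \<beta> \<alpha> (Part 0) (\<beta> \<alpha> 0)" by (simp add: copy_of_limit)
    show ?thesis using active_copyI[OF assms c less.IH[OF copy_of_less[OF assms c]]] by simp
  qed (simp_all add: dyadic_diamond_0 diamond_zero_def active_osucc two_subsets_def original_D1_def)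
qed

lemma Mid_Mid_active: "{Mid 0, Mid 1} \<in> active (dyadic_diamond \<beta> (osucc \<gamma>))"
  by (simp add: active_osucc two_subsets_def original_D1_def)

text \<open>Up to symmetry an active pair is the top and bottom of the trivial diamond, a pair of points of
  an original first diamond, or the image of an active pair of a copy.\<close>

lemma active_induct [consumes 2, case_names sym zero Top_Bot Top_Mid Mid_Bot Mid_Mid copy]:
  assumes enum: "limit_enumeration \<beta>" and act: "{u, v} \<in> active (dyadic_diamond \<beta> \<alpha>)"
    and sym: "\<And>\<alpha> u v. {u, v} \<in> active (dyadic_diamond \<beta> \<alpha>) \<Longrightarrow> P \<alpha> u v \<Longrightarrow> P \<alpha> v u"
    and zero: "P 0 Top Bot"
    and Top_Bot: "\<And>\<gamma>. P (osucc \<gamma>) Top Bot"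
    and Top_Mid: "\<And>\<gamma> i. i \<in> {0, 1} \<Longrightarrow> P (osucc \<gamma>) Top (Mid i)"
    and Mid_Bot: "\<And>\<gamma> i. i \<in> {0, 1} \<Longrightarrow> P (osucc \<gamma>) (Mid i) Bot"
    and Mid_Mid: "\<And>\<gamma>. P (osucc \<gamma>) (Mid 0) (Mid 1)"
    and copy: "\<And>\<alpha> c \<gamma> p q. copy_of \<beta> \<alpha> c \<gamma> \<Longrightarrow> {p, q} \<in> active (dyadic_diamond \<beta> \<gamma>) \<Longrightarrow>
      P \<gamma> p q \<Longrightarrow> P \<alpha> (glue c p) (glue c q)"
  shows "P \<alpha> u v"
  using act
proof (induction \<alpha> arbitrary: u v rule: less_induct)
  case (less \<alpha>)
  have sym': "P \<alpha> u v \<longleftrightarrow> P \<alpha> v u"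
    using sym less.prems by (metis insert_commute)
  from enum less.prems show ?case
  proof (cases rule: activeE)
    case z: zero
    then show ?thesis using zero sym' by (auto simp: doubleton_eq_iff)
  next
    case (original \<gamma>)
    then have "u \<noteq> v" "u \<in> original_D1" "v \<in> original_D1"
      by (auto simp: two_subsets_def card_2_iff)
    then show ?thesis
      using sym' Top_Bot[of \<gamma>] Top_Mid[of 0 \<gamma>] Top_Mid[of 1 \<gamma>] Mid_Bot[of 0 \<gamma>] Mid_Bot[of 1 \<gamma>]
        Mid_Mid[of \<gamma>]
      by (auto simp: original_D1_def original(1))
  next
    case c: (copy c \<gamma> P')
    obtain a b where "P' = {a, b}" using active_doubleton[OF enum c(2)] by blast
    then obtain p q where P': "P' = {p, q}" and uv: "u = glue c p" "v = glue c q"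
      using c(3) by (auto simp: doubleton_eq_iff)
    show ?thesis
      using copy[OF c(1)] less.IH[OF copy_of_less[OF enum c(1)]] c(2) unfolding uv P' by blast
  qed
qed

lemma active_in_points:
  assumes "limit_enumeration \<beta>" "{p, q} \<in> active (dyadic_diamond \<beta> \<alpha>)"
  shows "p \<in> points (dyadic_diamond \<beta> \<alpha>)" "q \<in> points (dyadic_diamond \<beta> \<alpha>)"
  using active_doubleton[OF assms] by (auto simp: doubleton_eq_iff)

section \<open>From trees to maps on diamonds\<close>

text \<open>The recursion is over the points, so that one equation system covers the diamonds of all
  indices; the increments of the map on a copy are the vectors of a subtree. Well-definedness at the
  glued points is the content of the next two lemmas.\<close>

fun diamond_map :: "(nat list \<Rightarrow> 'a::real_vector) \<Rightarrow> dpoint \<Rightarrow> 'a" where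
  "diamond_map x Top = x []"
| "diamond_map x Bot = 0"
| "diamond_map x (Mid i) = (1/2) *\<^sub>R x [i]"
| "diamond_map x (Inner (Upper i) p) =
     (1/2) *\<^sub>R x [i] + (1/2) *\<^sub>R diamond_map (\<lambda>s. x ((1 - i) # s)) p"
| "diamond_map x (Inner (Lower i) p) = (1/2) *\<^sub>R diamond_map (\<lambda>s. x (i # s)) p"
| "diamond_map x (Inner (Part n) p) = diamond_map (\<lambda>s. x (n # s)) p"

lemma diamond_map_glue_binary:
  assumes "x [] = (1/2) *\<^sub>R (x [0] + x [1])" "c \<in> binary_labels"
  shows "\<exists>a. \<forall>p. diamond_map x (glue c p) = a + (1/2) *\<^sub>R diamond_map (\<lambda>s. x (child c # s)) p"
proof (cases c)
  case (Upper i)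
  then have i: "i = 0 \<or> i = 1" using assms(2) by (auto simp: binary_labels_def)
  have "diamond_map x (glue c p) =
      (1/2) *\<^sub>R x [i] + (1/2) *\<^sub>R diamond_map (\<lambda>s. x (child c # s)) p" for p
    using assms(1) i by (cases p) (auto simp: Upper scaleR_add_right add.commute)
  then show ?thesis by blast
next
  case (Lower i)
  have "diamond_map x (glue c p) = 0 + (1/2) *\<^sub>R diamond_map (\<lambda>s. x (child c # s)) p" for p
    by (cases p) (auto simp: Lower)
  then show ?thesis by blast
qed (use assms(2) in \<open>auto simp: binary_labels_def\<close>)

lemma diamond_map_glue_diff:
  assumes "limit_enumeration \<beta>" "copy_of \<beta> \<alpha> c \<gamma>" "delta_tree \<beta> \<delta> \<alpha> x"
  shows "diamond_map x (glue c p) - diamond_map x (glue c q) =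
    copy_scale c *\<^sub>R (diamond_map (\<lambda>s. x (child c # s)) p - diamond_map (\<lambda>s. x (child c # s)) q)"
proof (cases \<alpha> rule: omega1_cases)
  case (succ \<gamma>')
  then have "c \<in> binary_labels" "x [] = (1/2) *\<^sub>R (x [0] + x [1])"
    using assms by (auto simp: copy_of_osucc delta_tree_osucc)
  then show ?thesis
    using diamond_map_glue_binary[of x c] by (auto simp: copy_scale_binary scaleR_diff_right)
next
  case limit
  obtain n where n: "c = Part n" "x [] = x [n]"
    using assms(2,3) unfolding copy_of_limit[OF limit] delta_tree_limit[OF assms(1) limit] by blast
  then have "diamond_map x (glue c p) = diamond_map (\<lambda>s. x (child c # s)) p" for p
    by (cases p) auto
  then show ?thesis by (simp add: n)
qed (use copy_of_nonzero[OF assms(2)] in simp)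

text \<open>A bound for the links suffices for a path metric, and on a link the inductive hypothesis applies
  to the subtree that belongs to the copy.\<close>

lemma diamond_map_Lipschitz:
  fixes x :: "nat list \<Rightarrow> 'a::real_normed_vector"
  assumes "limit_enumeration \<beta>" "delta_tree \<beta> \<delta> \<alpha> x" "\<And>s. s \<in> tree \<beta> \<alpha> \<Longrightarrow> norm (x s) \<le> B" "0 < B"
    and "u \<in> points (dyadic_diamond \<beta> \<alpha>)" "v \<in> points (dyadic_diamond \<beta> \<alpha>)"
  shows "norm (diamond_map x u - diamond_map x v) \<le> B * ddist (dyadic_diamond \<beta> \<alpha>) u v"
  using assms(2,3,5,6)
proof (induction \<alpha> arbitrary: x u v rule: less_induct)
  case (less \<alpha>)
  show ?case
  proof (cases "\<alpha> = 0")
    case True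
    then show ?thesis using less.prems by (auto simp: dyadic_diamond_0 diamond_zero_def tree_0)
  next
    case False
    have "norm (diamond_map x u - diamond_map x v) \<le> B * w" if "diamond_link \<beta> \<alpha> u v w" for u v w
    proof -
      from that obtain c \<gamma> p q where c: "copy_of \<beta> \<alpha> c \<gamma>"
        and pq: "p \<in> points (dyadic_diamond \<beta> \<gamma>)" "q \<in> points (dyadic_diamond \<beta> \<gamma>)"
        and eq: "u = glue c p" "v = glue c q" "w = copy_scale c * ddist (dyadic_diamond \<beta> \<gamma>) p q"
        by (rule diamond_linkE)
      have "norm (diamond_map (\<lambda>s. x (child c # s)) p - diamond_map (\<lambda>s. x (child c # s)) q)
          \<le> B * ddist (dyadic_diamond \<beta> \<gamma>) p q"
        by (rule less.IH[OF copy_of_less[OF assms(1) c] delta_tree_copy[OF assms(1) c less.prems(1)] _ pq])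
          (rule less.prems(2)[OF tree_copy[OF assms(1) c]])
      then show ?thesis
        using copy_scale_pos[of c]
        by (simp add: eq diamond_map_glue_diff[OF assms(1) c less.prems(1)] mult.left_commute[of B])
    qed
    then show ?thesis
      unfolding ddist_eq_path_metric[OF assms(1) False]
      by (rule Lipschitz_path_metric[OF _ \<open>0 < B\<close> diamond_connected[OF assms(1) False less.prems(3,4)]])
  qed
qed

text \<open>Two adjacent points of an original first diamond differ by half of a vector of the tree, top and
  bottom differ by the root, and the two middle points by half the difference of two siblings. On a
  copy the distances shrink at least by the scale of the copy, while the increments of the map shrink
  exactly by it.\<close>

lemma diamond_map_active_lower:
  fixes x :: "nat list \<Rightarrow> 'a::real_normed_vector"
  assumes "limit_enumeration \<beta>" "{u, v} \<in> active (dyadic_diamond \<beta> \<alpha>)"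
    and "delta_tree \<beta> \<delta> \<alpha> x" "\<And>s. s \<in> tree \<beta> \<alpha> \<Longrightarrow> A \<le> norm (x s)" "0 < A" "A \<le> \<delta>"
  shows "A * ddist (dyadic_diamond \<beta> \<alpha>) u v \<le> norm (diamond_map x u - diamond_map x v)"
  using assms(1-4)
proof (induction arbitrary: x rule: active_induct)
  case (sym \<alpha> u v)
  have "ddist (dyadic_diamond \<beta> \<alpha>) u v = ddist (dyadic_diamond \<beta> \<alpha>) v u"
    using ddist_sym_nonneg[OF assms(1) active_in_points[OF assms(1) sym(1)]] by blast
  then show ?case
    using sym(2)[OF sym(3,4)] by (simp add: norm_minus_commute)
next
  case zero
  then show ?case by (simp add: dyadic_diamond_0 diamond_zero_def tree_0)
next
  case (Top_Bot \<gamma>)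
  have "A * ddist (dyadic_diamond \<beta> (osucc \<gamma>)) Top Bot \<le> A"
    using mult_left_mono[OF ddist_Top_Bot_le[OF assms(1), of "osucc \<gamma>"], of A] \<open>0 < A\<close> by simp
  then show ?case using Top_Bot(2)[OF Nil_in_tree[OF assms(1)]] by simp
next
  case (Top_Mid \<gamma> i)
  have "A * ddist (dyadic_diamond \<beta> (osucc \<gamma>)) Top (Mid i) \<le> A / 2"
    using mult_left_mono[OF ddist_original_le(1)[OF assms(1) Top_Mid(1), of \<gamma>], of A] \<open>0 < A\<close> by simp
  moreover have "[1 - i] \<in> tree \<beta> (osucc \<gamma>)"
    using Top_Mid(1) Nil_in_tree[OF assms(1), of \<gamma>] by (auto simp: tree_osucc)
  moreover have "x [] - (1/2) *\<^sub>R x [i] = (1/2) *\<^sub>R x [1 - i]"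
    using Top_Mid(1,2) by (auto simp: delta_tree_osucc[OF assms(1)] scaleR_add_right)
  ultimately show ?case using Top_Mid(3)[of "[1 - i]"] by simp
next
  case (Mid_Bot \<gamma> i)
  have "A * ddist (dyadic_diamond \<beta> (osucc \<gamma>)) (Mid i) Bot \<le> A / 2"
    using mult_left_mono[OF ddist_original_le(2)[OF assms(1) Mid_Bot(1), of \<gamma>], of A] \<open>0 < A\<close> by simp
  moreover have "[i] \<in> tree \<beta> (osucc \<gamma>)"
    using Mid_Bot(1) Nil_in_tree[OF assms(1), of \<gamma>] by (auto simp: tree_osucc)
  ultimately show ?case using Mid_Bot(3)[of "[i]"] by simp
next
  case (Mid_Mid \<gamma>)
  have "A * ddist (dyadic_diamond \<beta> (osucc \<gamma>)) (Mid 0) (Mid 1) \<le> A"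
    using mult_left_mono[OF ddist_original_le(3)[OF assms(1), of 0 \<gamma>], of A] \<open>0 < A\<close> by simp
  also have "\<dots> \<le> 1/2 * norm (x [0] - x [1])"
    using Mid_Mid(1) \<open>A \<le> \<delta>\<close> by (simp add: delta_tree_osucc[OF assms(1)])
  also have "\<dots> = norm (diamond_map x (Mid 0) - diamond_map x (Mid 1))"
    by (simp flip: scaleR_diff_right)
  finally show ?case .
next
  case (copy \<alpha> c \<gamma> p q)
  have "A * ddist (dyadic_diamond \<beta> \<gamma>) p q \<le>
      norm (diamond_map (\<lambda>s. x (child c # s)) p - diamond_map (\<lambda>s. x (child c # s)) q)"
    by (rule copy.IH[OF delta_tree_copy[OF assms(1) copy(1) copy(4)]])
      (rule copy(5)[OF tree_copy[OF assms(1) copy(1)]])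
  then have "copy_scale c * (A * ddist (dyadic_diamond \<beta> \<gamma>) p q) \<le>
      norm (diamond_map x (glue c p) - diamond_map x (glue c q))"
    using copy_scale_pos[of c] by (simp add: diamond_map_glue_diff[OF assms(1) copy(1,4)])
  moreover have "A * ddist (dyadic_diamond \<beta> \<alpha>) (glue c p) (glue c q) \<le>
      A * (copy_scale c * ddist (dyadic_diamond \<beta> \<gamma>) p q)"
    using ddist_copy_le[OF assms(1) copy(1)] active_in_points[OF assms(1) copy(2)] \<open>0 < A\<close> by simp
  ultimately show ?case by (simp add: mult.left_commute)
qed

section \<open>Copies are scaled isometrically on active pairs\<close>

text \<open>Above a successor step the given tree is repeated in both subtrees, so that its root is the mean
  of the two roots; at a limit step the other subtrees are filled with constant trees. The nodes that
  are added have successors with equal vectors, which is why the trees here have parameter \<open>0\<close>.\<close>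

lemma extend_tree_from_copy:
  fixes x :: "nat list \<Rightarrow> 'a::real_normed_vector"
  assumes enum: "limit_enumeration \<beta>" and c: "copy_of \<beta> \<alpha> c \<gamma>"
    and x: "delta_tree \<beta> 0 \<gamma> x" and B: "\<And>s. s \<in> tree \<beta> \<gamma> \<Longrightarrow> norm (x s) \<le> B"
  shows "\<exists>y. delta_tree \<beta> 0 \<alpha> y \<and> (\<forall>s\<in>tree \<beta> \<alpha>. norm (y s) \<le> B) \<and>
    (\<lambda>s. y (child c # s)) = x"
proof (cases \<alpha> rule: omega1_cases)
  case (succ \<gamma>')
  then have \<gamma>: "\<gamma>' = \<gamma>" using c by (simp add: copy_of_osucc)
  have "x [] = (1/2) *\<^sub>R (x [] + x [])"
    using scaleR_half_double[of "x []"] by (simp add: scaleR_add_right)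
  then have "delta_tree \<beta> 0 \<alpha> (\<lambda>s. x (tl s))"
    unfolding succ \<gamma> delta_tree_osucc[OF enum] list.sel using x by simp
  moreover have "norm (x (tl s)) \<le> B" if "s \<in> tree \<beta> \<alpha>" for s
    using that B Nil_in_tree[OF enum, of \<gamma>] unfolding succ \<gamma> tree_osucc by auto
  ultimately show ?thesis by (intro exI[of _ "\<lambda>s. x (tl s)"]) simp
next
  case limit
  obtain n where n: "c = Part n" "\<gamma> = \<beta> \<alpha> n" using c unfolding copy_of_limit[OF limit] by blast
  define y where "y s = (case s of [] \<Rightarrow> x [] | m # t \<Rightarrow> if m = n then x t else x [])" for s
  have "delta_tree \<beta> 0 (\<beta> \<alpha> m) (\<lambda>s. y (m # s))" for m
    using x delta_tree_const[of \<beta> "\<beta> \<alpha> m" "x []"] n(2) by (cases "m = n") (simp_all add: y_def)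
  then have "delta_tree \<beta> 0 \<alpha> y"
    unfolding delta_tree_limit[OF enum limit] by (simp add: y_def)
  moreover have "norm (y s) \<le> B" if "s \<in> tree \<beta> \<alpha>" for s
    using that B Nil_in_tree[OF enum, of \<gamma>] n(2) unfolding tree_limit[OF enum limit]
    by (auto simp: y_def)
  ultimately show ?thesis by (intro exI[of _ y]) (simp add: n y_def)
qed (use copy_of_nonzero[OF c] in simp)

text \<open>The tree has root \<open>0\<close> and successors \<open>1\<close> and \<open>- 1\<close>, so that the middle points go to \<open>1/2\<close> and
  \<open>- 1/2\<close>.\<close>

lemma separating_tree_Mid:
  assumes "limit_enumeration \<beta>"
  shows "\<exists>x :: nat list \<Rightarrow> real. delta_tree \<beta> 0 (osucc \<gamma>) x \<and>
    (\<forall>s\<in>tree \<beta> (osucc \<gamma>). norm (x s) \<le> 1) \<and> diamond_map x (Mid 0) - diamond_map x (Mid 1) = 1"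
proof -
  define x :: "nat list \<Rightarrow> real" where
    "x s = (case s of [] \<Rightarrow> 0 | i # t \<Rightarrow> if i = 0 then 1 else - 1)" for s
  have "delta_tree \<beta> 0 (osucc \<gamma>) x"
    unfolding delta_tree_osucc[OF assms] by (simp add: x_def delta_tree_const)
  moreover have "norm (x s) \<le> 1" for s
    by (simp add: x_def split: list.split)
  moreover have "diamond_map x (Mid 0) - diamond_map x (Mid 1) = 1" by (simp add: x_def)
  ultimately show ?thesis by blast
qed

text \<open>The constant tree \<open>1\<close> gives the height function of the diamond, which attains the distance of
  pairs on a common vertical line; the previous lemma deals with the two middle points. A tree for a
  pair of a copy is extended to the whole diamond.\<close>

lemma norming_tree_for_active_pair:
  assumes enum: "limit_enumeration \<beta>" and "{u, v} \<in> active (dyadic_diamond \<beta> \<alpha>)"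
  shows "\<exists>x :: nat list \<Rightarrow> real. delta_tree \<beta> 0 \<alpha> x \<and> (\<forall>s\<in>tree \<beta> \<alpha>. norm (x s) \<le> 1) \<and>
    ddist (dyadic_diamond \<beta> \<alpha>) u v \<le> norm (diamond_map x u - diamond_map x v)"
  using assms
proof (induction rule: active_induct)
  case (sym \<alpha> u v)
  have "ddist (dyadic_diamond \<beta> \<alpha>) u v = ddist (dyadic_diamond \<beta> \<alpha>) v u"
    using ddist_sym_nonneg[OF enum active_in_points[OF enum sym(1)]] by blast
  then show ?case using sym(2) by (simp add: abs_minus_commute)
next
  case zero
  show ?case
    by (intro exI[of _ "\<lambda>_. 1"]) (simp add: delta_tree_const dyadic_diamond_0 diamond_zero_def)
next
  case (Top_Bot \<gamma>)
  show ?case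
    using ddist_Top_Bot_le[OF enum]
    by (intro exI[of _ "\<lambda>_. 1"]) (simp add: delta_tree_const)
next
  case (Top_Mid \<gamma> i)
  show ?case
    using ddist_original_le(1)[OF enum Top_Mid]
    by (intro exI[of _ "\<lambda>_. 1"]) (simp add: delta_tree_const)
next
  case (Mid_Bot \<gamma> i)
  show ?case
    using ddist_original_le(2)[OF enum Mid_Bot]
    by (intro exI[of _ "\<lambda>_. 1"]) (simp add: delta_tree_const)
next
  case (Mid_Mid \<gamma>)
  obtain x :: "nat list \<Rightarrow> real" where "delta_tree \<beta> 0 (osucc \<gamma>) x"
    "\<forall>s\<in>tree \<beta> (osucc \<gamma>). norm (x s) \<le> 1" "diamond_map x (Mid 0) - diamond_map x (Mid 1) = 1"
    using separating_tree_Mid[OF enum] by blast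
  then show ?case
    using ddist_original_le(3)[OF enum, of 0 \<gamma>] by (intro exI[of _ x]) (simp del: diamond_map.simps)
next
  case (copy \<alpha> c \<gamma> p q)
  obtain x :: "nat list \<Rightarrow> real" where x: "delta_tree \<beta> 0 \<gamma> x" "\<forall>s\<in>tree \<beta> \<gamma>. norm (x s) \<le> 1"
    and le: "ddist (dyadic_diamond \<beta> \<gamma>) p q \<le> norm (diamond_map x p - diamond_map x q)"
    using copy(3) by blast
  obtain y where y: "delta_tree \<beta> 0 \<alpha> y" "\<forall>s\<in>tree \<beta> \<alpha>. norm (y s) \<le> 1"
    and yx: "(\<lambda>s. y (child c # s)) = x"
    using extend_tree_from_copy[OF enum copy(1) x(1)] x(2) by blast
  have "ddist (dyadic_diamond \<beta> \<alpha>) (glue c p) (glue c q)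
      \<le> copy_scale c * ddist (dyadic_diamond \<beta> \<gamma>) p q"
    by (rule ddist_copy_le[OF enum copy(1) active_in_points[OF enum copy(2)]])
  also have "\<dots> \<le> copy_scale c * norm (diamond_map x p - diamond_map x q)"
    using le copy_scale_pos[of c] by simp
  also have "\<dots> = norm (diamond_map y (glue c p) - diamond_map y (glue c q))"
    unfolding diamond_map_glue_diff[OF enum copy(1) y(1)] yx norm_scaleR using copy_scale_pos[of c] by simp
  finally show ?case using y by blast
qed

text \<open>A path that leaves the copy and comes back is no shortcut for an active pair: the norming tree of
  the pair extends to the whole diamond, where its map is still \<open>1\<close>-Lipschitz.\<close>

lemma ddist_copy_active:
  assumes enum: "limit_enumeration \<beta>" and c: "copy_of \<beta> \<alpha> c \<gamma>"
    and pq: "{p, q} \<in> active (dyadic_diamond \<beta> \<gamma>)"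
  shows "ddist (dyadic_diamond \<beta> \<alpha>) (glue c p) (glue c q) =
    copy_scale c * ddist (dyadic_diamond \<beta> \<gamma>) p q"
proof (rule antisym)
  show "ddist (dyadic_diamond \<beta> \<alpha>) (glue c p) (glue c q)
      \<le> copy_scale c * ddist (dyadic_diamond \<beta> \<gamma>) p q"
    by (rule ddist_copy_le[OF enum c active_in_points[OF enum pq]])
  obtain x :: "nat list \<Rightarrow> real" where x: "delta_tree \<beta> 0 \<gamma> x" "\<forall>s\<in>tree \<beta> \<gamma>. norm (x s) \<le> 1"
    and le: "ddist (dyadic_diamond \<beta> \<gamma>) p q \<le> norm (diamond_map x p - diamond_map x q)"
    using norming_tree_for_active_pair[OF enum pq] by blast
  obtain y where y: "delta_tree \<beta> 0 \<alpha> y" "\<forall>s\<in>tree \<beta> \<alpha>. norm (y s) \<le> 1"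
    and yx: "(\<lambda>s. y (child c # s)) = x"
    using extend_tree_from_copy[OF enum c x(1)] x(2) by blast
  have "copy_scale c * ddist (dyadic_diamond \<beta> \<gamma>) p q
      \<le> copy_scale c * norm (diamond_map x p - diamond_map x q)"
    using le copy_scale_pos[of c] by simp
  also have "\<dots> = norm (diamond_map y (glue c p) - diamond_map y (glue c q))"
    unfolding diamond_map_glue_diff[OF enum c y(1)] yx norm_scaleR using copy_scale_pos[of c] by simp
  also have "\<dots> \<le> 1 * ddist (dyadic_diamond \<beta> \<alpha>) (glue c p) (glue c q)"
    using diamond_map_Lipschitz[OF enum y(1) _ zero_less_one
        active_in_points[OF enum active_copyI[OF enum c pq]]] y(2) by blast
  finally show "copy_scale c * ddist (dyadic_diamond \<beta> \<gamma>) p q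
      \<le> ddist (dyadic_diamond \<beta> \<alpha>) (glue c p) (glue c q)" by simp
qed

lemma ddist_Mid_Mid:
  assumes enum: "limit_enumeration \<beta>"
  shows "ddist (dyadic_diamond \<beta> (osucc \<gamma>)) (Mid 0) (Mid 1) = 1"
proof (rule antisym)
  show "ddist (dyadic_diamond \<beta> (osucc \<gamma>)) (Mid 0) (Mid 1) \<le> 1"
    using ddist_original_le(3)[OF enum, of 0] by simp
  obtain x :: "nat list \<Rightarrow> real" where x: "delta_tree \<beta> 0 (osucc \<gamma>) x"
    "\<forall>s\<in>tree \<beta> (osucc \<gamma>). norm (x s) \<le> 1" "diamond_map x (Mid 0) - diamond_map x (Mid 1) = 1"
    using separating_tree_Mid[OF enum] by blast
  show "1 \<le> ddist (dyadic_diamond \<beta> (osucc \<gamma>)) (Mid 0) (Mid 1)"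
    using diamond_map_Lipschitz[OF enum x(1) _ zero_less_one active_in_points[OF enum Mid_Mid_active]]
      x(2) unfolding x(3) by simp
qed

section \<open>From maps on diamonds to trees\<close>

text \<open>The difference of the upper and the lower vector at the middle point \<open>i\<close> is twice
  \<open>f Top + f Bot - 2 f (Mid i)\<close>. These expressions for \<open>i = 0\<close> and \<open>i = 1\<close> differ by
  \<open>2 (f (Mid 0) - f (Mid 1))\<close>, so they cannot both have norm less than \<open>A\<close>.\<close>

lemma midpoint_split:
  fixes f :: "dpoint \<Rightarrow> 'a::real_normed_vector"
  assumes "A \<le> norm (f (Mid 0) - f (Mid 1))"
  shows "\<exists>i\<in>{0, 1}.
    A \<le> 1/2 * norm (2 *\<^sub>R (f Top - f (Mid i)) - 2 *\<^sub>R (f (Mid i) - f Bot))"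
proof (rule ccontr)
  define w where "w i = f Top + f Bot - 2 *\<^sub>R f (Mid i)" for i
  have w: "2 *\<^sub>R (f Top - f (Mid i)) - 2 *\<^sub>R (f (Mid i) - f Bot) = 2 *\<^sub>R w i" for i
    by (simp add: w_def algebra_simps scaleR_2)
  assume "\<not> ?thesis"
  then have "norm (w 0) < A" "norm (w 1) < A" by (simp_all add: w)
  moreover have "2 *\<^sub>R (f (Mid 0) - f (Mid 1)) = w 1 - w 0"
    by (simp add: w_def scaleR_diff_right)
  then have "2 * norm (f (Mid 0) - f (Mid 1)) = norm (w 1 - w 0)"
    by (metis abs_numeral norm_scaleR)
  ultimately show False
    using assms norm_triangle_ineq4[of "w 1" "w 0"] by linarith
qed

text \<open>On each copy \<open>f\<close>, divided by the scale of the copy, satisfies the same hypotheses, with the same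
  constants, because distances of active pairs are scaled exactly. At a successor step only the two
  copies at a middle point chosen by \<open>midpoint_split\<close> are used.\<close>

lemma tree_from_sub_Lipschitz_map:
  fixes f :: "dpoint \<Rightarrow> 'a::real_normed_vector"
  assumes enum: "limit_enumeration \<beta>" and "0 \<le> B"
    and f: "\<And>u v. {u, v} \<in> active (dyadic_diamond \<beta> \<alpha>) \<Longrightarrow>
      A * ddist (dyadic_diamond \<beta> \<alpha>) u v \<le> norm (f u - f v) \<and>
      norm (f u - f v) \<le> B * ddist (dyadic_diamond \<beta> \<alpha>) u v"
  shows "\<exists>x. delta_tree \<beta> A \<alpha> x \<and> x [] = f Top - f Bot \<and> (\<forall>s\<in>tree \<beta> \<alpha>. norm (x s) \<le> B)"
  using f
proof (induction \<alpha> arbitrary: f rule: less_induct)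
  case (less \<alpha>)
  have root: "norm (f Top - f Bot) \<le> B"
    using less.prems[OF Top_Bot_active[OF enum]] mult_left_mono[OF ddist_Top_Bot_le[OF enum] \<open>0 \<le> B\<close>, of \<alpha>]
    by simp
  have sub: "\<exists>x. delta_tree \<beta> A \<gamma> x \<and>
      x [] = (1 / copy_scale c) *\<^sub>R (f (glue c Top) - f (glue c Bot)) \<and>
      (\<forall>s\<in>tree \<beta> \<gamma>. norm (x s) \<le> B)" if c: "copy_of \<beta> \<alpha> c \<gamma>" for c \<gamma>
  proof -
    let ?g = "\<lambda>p. (1 / copy_scale c) *\<^sub>R f (glue c p)"
    have "A * ddist (dyadic_diamond \<beta> \<gamma>) p q \<le> norm (?g p - ?g q) \<and>
        norm (?g p - ?g q) \<le> B * ddist (dyadic_diamond \<beta> \<gamma>) p q"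
      if pq: "{p, q} \<in> active (dyadic_diamond \<beta> \<gamma>)" for p q
    proof -
      have norm_g: "norm (?g p - ?g q) = norm (f (glue c p) - f (glue c q)) / copy_scale c"
        using copy_scale_pos[of c] by (simp flip: scaleR_diff_right)
      show ?thesis
        using less.prems[OF active_copyI[OF enum c pq]] copy_scale_pos[of c]
        unfolding norm_g ddist_copy_active[OF enum c pq] by (simp add: field_simps)
    qed
    from less.IH[OF copy_of_less[OF enum c] this] show ?thesis by (simp add: scaleR_diff_right)
  qed
  show ?case
  proof (cases \<alpha> rule: omega1_cases)
    case zero
    then show ?thesis
      using root by (intro exI[of _ "\<lambda>_. f Top - f Bot"]) (simp add: delta_tree_0)
  next
    case (succ \<gamma>)
    have "A \<le> norm (f (Mid 0) - f (Mid 1))"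
      using less.prems[of "Mid 0" "Mid 1"] Mid_Mid_active[of \<beta> \<gamma>] ddist_Mid_Mid[OF enum, of \<gamma>]
      by (simp add: succ)
    then obtain i where i: "i \<in> {0, 1}"
      and gap: "A \<le> 1/2 * norm (2 *\<^sub>R (f Top - f (Mid i)) - 2 *\<^sub>R (f (Mid i) - f Bot))"
      using midpoint_split by blast
    have "copy_of \<beta> \<alpha> (Upper i) \<gamma>" "copy_of \<beta> \<alpha> (Lower i) \<gamma>"
      using i by (auto simp: succ copy_of_osucc binary_labels_def)
    then obtain x\<^sub>0 x\<^sub>1 where x\<^sub>0: "delta_tree \<beta> A \<gamma> x\<^sub>0" "x\<^sub>0 [] = 2 *\<^sub>R (f Top - f (Mid i))"
        "\<forall>s\<in>tree \<beta> \<gamma>. norm (x\<^sub>0 s) \<le> B"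
      and x\<^sub>1: "delta_tree \<beta> A \<gamma> x\<^sub>1" "x\<^sub>1 [] = 2 *\<^sub>R (f (Mid i) - f Bot)"
        "\<forall>s\<in>tree \<beta> \<gamma>. norm (x\<^sub>1 s) \<le> B"
      using sub[of "Upper i" \<gamma>] sub[of "Lower i" \<gamma>] by auto
    define x where
      "x s = (case s of [] \<Rightarrow> f Top - f Bot | j # t \<Rightarrow> if j = 0 then x\<^sub>0 t else x\<^sub>1 t)" for s
    have "f Top - f Bot = (1/2) *\<^sub>R (2 *\<^sub>R (f Top - f (Mid i)) + 2 *\<^sub>R (f (Mid i) - f Bot))"
      by (simp add: scaleR_add_right)
    then have "delta_tree \<beta> A \<alpha> x"
      unfolding succ delta_tree_osucc[OF enum] using x\<^sub>0 x\<^sub>1 gap by (simp add: x_def)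
    moreover have "\<forall>s\<in>tree \<beta> \<alpha>. norm (x s) \<le> B"
      unfolding succ tree_osucc using x\<^sub>0(3) x\<^sub>1(3) root by (auto simp: x_def)
    moreover have "x [] = f Top - f Bot" by (simp add: x_def)
    ultimately show ?thesis by blast
  next
    case limit
    have "\<forall>n. \<exists>x. delta_tree \<beta> A (\<beta> \<alpha> n) x \<and> x [] = f Top - f Bot \<and>
        (\<forall>s\<in>tree \<beta> (\<beta> \<alpha> n). norm (x s) \<le> B)"
      using sub[of "Part _"] by (simp add: copy_of_limit[OF limit])
    then obtain X where X: "\<And>n. delta_tree \<beta> A (\<beta> \<alpha> n) (X n) \<and> X n [] = f Top - f Bot \<and>
        (\<forall>s\<in>tree \<beta> (\<beta> \<alpha> n). norm (X n s) \<le> B)" by metis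
    define x where "x s = (case s of [] \<Rightarrow> f Top - f Bot | n # t \<Rightarrow> X n t)" for s
    have "delta_tree \<beta> A \<alpha> x"
      unfolding delta_tree_limit[OF enum limit] using X by (simp add: x_def)
    moreover have "\<forall>s\<in>tree \<beta> \<alpha>. norm (x s) \<le> B"
      unfolding tree_limit[OF enum limit] using X root by (auto simp: x_def)
    moreover have "x [] = f Top - f Bot" by (simp add: x_def)
    ultimately show ?thesis by blast
  qed
qed

lemma Ord_less_DT_iff_diamond_embeds:
  fixes X :: "'a::real_normed_vector itself"
  assumes enum: "limit_enumeration \<beta>" and "0 < \<alpha>"
  shows "Ord \<alpha> < DT \<beta> X \<longleftrightarrow> sub_Lipschitz_embeds (dyadic_diamond \<beta> \<alpha>) X"
proof
  assume "Ord \<alpha> < DT \<beta> X"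
  then obtain \<delta> where "0 < \<delta>" and \<delta>: "ball_contains_tree \<beta> X \<delta> \<alpha>"
    using Ord_less_DT_iff[OF enum] by blast
  then obtain x :: "nat list \<Rightarrow> 'a" where x: "delta_tree \<beta> \<delta> \<alpha> x"
    and x1: "\<And>s. s \<in> tree \<beta> \<alpha> \<Longrightarrow> norm (x s) \<le> 1"
    unfolding ball_contains_tree_def by (auto simp: image_subset_iff)
  \<comment> \<open>A tree of index \<open>1\<close> has two distinct vectors, so the space contains vectors of norm \<open>2\<close>.\<close>
  have "ball_contains_tree \<beta> X \<delta> (osucc 0)"
    using ball_contains_tree_mono[OF enum \<delta>] \<open>0 < \<alpha>\<close> by (simp add: osucc_le_iff)
  then obtain y :: "nat list \<Rightarrow> 'a" where "\<delta> \<le> 1/2 * norm (y [0] - y [1])"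
    unfolding ball_contains_tree_def delta_tree_osucc[OF enum] by blast
  then have "y [0] - y [1] \<noteq> 0" using \<open>0 < \<delta>\<close> by auto
  then obtain w :: 'a where "w \<noteq> 0" by blast
  define v where "v = (2 / norm w) *\<^sub>R w"
  have v: "norm v = 2" using \<open>w \<noteq> 0\<close> by (simp add: v_def)
  \<comment> \<open>Translation leaves sibling differences unchanged and moves all norms into \<open>[1, 3]\<close>.\<close>
  define z where "z s = v + 1 *\<^sub>R x s" for s
  have z: "delta_tree \<beta> \<delta> \<alpha> z"
    using delta_tree_affine[OF x, of 1 v] unfolding z_def by simp
  have z3: "norm (z s) \<le> 3" and z1: "min 1 \<delta> \<le> norm (z s)" if "s \<in> tree \<beta> \<alpha>" for s
    using x1[OF that] norm_triangle_ineq[of v "x s"] norm_diff_ineq[of v "x s"] by (auto simp: z_def v)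
  have "min 1 \<delta> * ddist (dyadic_diamond \<beta> \<alpha>) u v \<le> norm (diamond_map z u - diamond_map z v) \<and>
      norm (diamond_map z u - diamond_map z v) \<le> 3 * ddist (dyadic_diamond \<beta> \<alpha>) u v"
    if uv: "{u, v} \<in> active (dyadic_diamond \<beta> \<alpha>)" for u v
  proof
    show "min 1 \<delta> * ddist (dyadic_diamond \<beta> \<alpha>) u v \<le> norm (diamond_map z u - diamond_map z v)"
      by (rule diamond_map_active_lower[OF enum uv z z1]) (use \<open>0 < \<delta>\<close> in auto)
    show "norm (diamond_map z u - diamond_map z v) \<le> 3 * ddist (dyadic_diamond \<beta> \<alpha>) u v"
      by (rule diamond_map_Lipschitz[OF enum z z3 _ active_in_points[OF enum uv]]) auto
  qed
  then show "sub_Lipschitz_embeds (dyadic_diamond \<beta> \<alpha>) X"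
    unfolding sub_Lipschitz_embeds_def using \<open>0 < \<delta>\<close>
    by (intro exI[of _ "min 1 \<delta>"] exI[of _ 3] exI[of _ "diamond_map z"] conjI) auto
next
  assume "sub_Lipschitz_embeds (dyadic_diamond \<beta> \<alpha>) X"
  then obtain A B and f :: "dpoint \<Rightarrow> 'a" where "0 < A" "0 < B"
    and f: "\<And>u v. {u, v} \<in> active (dyadic_diamond \<beta> \<alpha>) \<Longrightarrow>
      A * ddist (dyadic_diamond \<beta> \<alpha>) u v \<le> norm (f u - f v) \<and>
      norm (f u - f v) \<le> B * ddist (dyadic_diamond \<beta> \<alpha>) u v"
    unfolding sub_Lipschitz_embeds_def by blast
  have "\<exists>x. delta_tree \<beta> A \<alpha> x \<and> x [] = f Top - f Bot \<and> (\<forall>s\<in>tree \<beta> \<alpha>. norm (x s) \<le> B)"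
    by (rule tree_from_sub_Lipschitz_map[OF enum less_imp_le[OF \<open>0 < B\<close>]]) (rule f)
  then obtain x :: "nat list \<Rightarrow> 'a" where x: "delta_tree \<beta> A \<alpha> x"
    and B: "\<forall>s\<in>tree \<beta> \<alpha>. norm (x s) \<le> B"
    by blast
  have "delta_tree \<beta> (1 / B * A) \<alpha> (\<lambda>s. 0 + (1 / B) *\<^sub>R x s)"
    by (rule delta_tree_affine[OF x]) (use \<open>0 < B\<close> in simp)
  moreover have "(\<lambda>s. 0 + (1 / B) *\<^sub>R x s) ` tree \<beta> \<alpha> \<subseteq> cball 0 1"
    using B \<open>0 < B\<close> by (auto simp: divide_le_eq)
  ultimately have "ball_contains_tree \<beta> X (1 / B * A) \<alpha>"
    unfolding ball_contains_tree_def by blast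
  then show "Ord \<alpha> < DT \<beta> X"
    unfolding Ord_less_DT_iff[OF enum] using \<open>0 < A\<close> \<open>0 < B\<close> by (intro exI[of _ "1 / B * A"]) simp
qed

section \<open>Bi-Lipschitz embeddings\<close>

lemma sub_Lipschitz_embeds_bi_Lipschitz:
  fixes X :: "'a::real_normed_vector itself" and Y :: "'b::real_normed_vector itself"
  assumes "bi_Lipschitz_embeds Y X" "sub_Lipschitz_embeds D Y"
  shows "sub_Lipschitz_embeds D X"
proof -
  obtain A B and g :: "'b \<Rightarrow> 'a" where AB: "0 < A" "0 < B"
    and g: "\<And>u v. A * norm (u - v) \<le> norm (g u - g v)" "\<And>u v. norm (g u - g v) \<le> B * norm (u - v)"
    using assms(1) unfolding bi_Lipschitz_embeds_def dist_norm by blast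
  obtain A' B' and f :: "dpoint \<Rightarrow> 'b" where AB': "0 < A'" "0 < B'"
    and f: "\<And>u v. {u, v} \<in> active D \<Longrightarrow> A' * ddist D u v \<le> norm (f u - f v)"
      "\<And>u v. {u, v} \<in> active D \<Longrightarrow> norm (f u - f v) \<le> B' * ddist D u v"
    using assms(2) unfolding sub_Lipschitz_embeds_def by blast
  have "A * A' * ddist D u v \<le> norm (g (f u) - g (f v)) \<and>
      norm (g (f u) - g (f v)) \<le> B * B' * ddist D u v" if uv: "{u, v} \<in> active D" for u v
    using order_trans[OF mult_left_mono[OF f(1)[OF uv] less_imp_le[OF AB(1)]] g(1)[of "f u" "f v"]]
      order_trans[OF g(2)[of "f u" "f v"] mult_left_mono[OF f(2)[OF uv] less_imp_le[OF AB(2)]]]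
    by (simp add: mult.assoc)
  then show ?thesis
    unfolding sub_Lipschitz_embeds_def using AB AB'
    by (intro exI[of _ "A * A'"] exI[of _ "B * B'"] exI[of _ "\<lambda>p. g (f p)"] conjI) auto
qed

text \<open>If the index of \<open>X\<close> were smaller, it would be an ordinal \<open>\<alpha>\<close>, and the diamond of index \<open>\<alpha>\<close> would
  embed into \<open>Y\<close>, hence into \<open>X\<close>, so that the index of \<open>X\<close> would exceed \<open>\<alpha>\<close>. The ordinal \<open>0\<close> is
  excluded because a tree of index \<open>0\<close> is a single vector.\<close>

lemma DT_bi_Lipschitz_mono:
  fixes X :: "'a::real_normed_vector itself" and Y :: "'b::real_normed_vector itself"
  assumes enum: "limit_enumeration \<beta>" and emb: "bi_Lipschitz_embeds Y X"
  shows "DT \<beta> Y \<le> DT \<beta> X"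
proof (rule ccontr)
  assume "\<not> ?thesis"
  then have less: "DT \<beta> X < DT \<beta> Y" by simp
  then obtain \<alpha> where \<alpha>: "DT \<beta> X = Ord \<alpha>"
    by (cases "DT \<beta> X") (auto simp: less_ext_ord_def)
  have "Ord \<alpha> < DT \<beta> X"
  proof (cases "\<alpha> = 0")
    case True
    have "ball_contains_tree \<beta> X 1 0"
      unfolding ball_contains_tree_def by (intro exI[of _ "\<lambda>_. 0"]) (auto simp: delta_tree_0)
    then show ?thesis unfolding Ord_less_DT_iff[OF enum] True by (intro exI[of _ 1]) simp
  next
    case False
    then have "0 < \<alpha>" using zero_le_omega1[of \<alpha>] by simp
    have "sub_Lipschitz_embeds (dyadic_diamond \<beta> \<alpha>) Y"
      using less unfolding \<alpha> Ord_less_DT_iff_diamond_embeds[OF enum \<open>0 < \<alpha>\<close>] .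
    from sub_Lipschitz_embeds_bi_Lipschitz[OF emb this] show ?thesis
      unfolding Ord_less_DT_iff_diamond_embeds[OF enum \<open>0 < \<alpha>\<close>] .
  qed
  then show False by (simp add: \<alpha>)
qed

definition dyadic_bush :: "real \<Rightarrow> (nat list \<Rightarrow> 'a::real_normed_vector) \<Rightarrow> bool" where
  "dyadic_bush \<delta> y \<longleftrightarrow> (\<forall>s \<in> lists {0, 1}. y s \<in> cball 0 1 \<and>
     y s = (1/2) *\<^sub>R (y (s @ [0]) + y (s @ [1])) \<and> 1/2 * norm (y (s @ [0]) - y (s @ [1])) \<ge> \<delta>)"

lemma infinite_tree_property_iff:
  fixes X :: "'a::real_normed_vector itself"
  shows "infinite_tree_property X \<longleftrightarrow> (\<exists>\<delta>>0. \<exists>y :: nat list \<Rightarrow> 'a. dyadic_bush \<delta> y)"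
  unfolding infinite_tree_property_def dyadic_bush_def ..

lemma dyadic_bush_root:
  assumes "dyadic_bush \<delta> y"
  shows "norm (y []) \<le> 1" "y [] = (1/2) *\<^sub>R (y [0] + y [1])" "\<delta> \<le> 1/2 * norm (y [0] - y [1])"
proof -
  have "y [] \<in> cball 0 1 \<and> y [] = (1/2) *\<^sub>R (y ([] @ [0]) + y ([] @ [1])) \<and>
      1/2 * norm (y ([] @ [0]) - y ([] @ [1])) \<ge> \<delta>"
    by (rule bspec[OF assms[unfolded dyadic_bush_def] lists.Nil])
  then show "norm (y []) \<le> 1" "y [] = (1/2) *\<^sub>R (y [0] + y [1])"
    "\<delta> \<le> 1/2 * norm (y [0] - y [1])"
    unfolding append_Nil mem_cball_0 by blast+
qed

lemma dyadic_bush_subtree: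
  assumes "dyadic_bush \<delta> y" "i \<in> {0, 1}"
  shows "dyadic_bush \<delta> (\<lambda>s. y (i # s))"
  unfolding dyadic_bush_def
proof
  fix s :: "nat list" assume "s \<in> lists {0, 1}"
  then have "i # s \<in> lists {0, 1}" by (rule lists.Cons[OF assms(2)])
  from bspec[OF assms(1)[unfolded dyadic_bush_def] this]
  show "y (i # s) \<in> cball 0 1 \<and> y (i # s) = (1/2) *\<^sub>R (y (i # s @ [0]) + y (i # s @ [1])) \<and>
      \<delta> \<le> 1/2 * norm (y (i # s @ [0]) - y (i # s @ [1]))" unfolding append_Cons .
qed

text \<open>The points of the infinite diamond are only met through the functions in \<open>S\<close>: restricting \<open>f\<close> to a
  copy and rescaling it stays in \<open>S\<close>, so the choice of a middle point can be repeated forever. A node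
  of the tree is the list of choices between the upper and the lower copy, and its vector is the
  difference of the values at top and bottom of the function reached by these restrictions.\<close>

lemma infinite_tree_property_from_dilations:
  fixes S :: "(dpoint \<Rightarrow> 'a::real_normed_vector) set"
  assumes "S \<noteq> {}" "0 < A" "0 < B"
    and dilate: "\<And>f c. f \<in> S \<Longrightarrow> c \<in> binary_labels \<Longrightarrow> (\<lambda>p. 2 *\<^sub>R f (glue c p)) \<in> S"
    and upper: "\<And>f. f \<in> S \<Longrightarrow> norm (f Top - f Bot) \<le> B"
    and lower: "\<And>f. f \<in> S \<Longrightarrow> A \<le> norm (f (Mid 0) - f (Mid 1))"
  shows "infinite_tree_property TYPE('a)"
proof -
  have "\<forall>f\<in>S. \<exists>i. i \<in> {0, 1} \<and>
      A \<le> 1/2 * norm (2 *\<^sub>R (f Top - f (Mid i)) - 2 *\<^sub>R (f (Mid i) - f Bot))"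
  proof
    fix f assume "f \<in> S"
    from midpoint_split[OF lower[OF this]] show "\<exists>i. i \<in> {0, 1} \<and>
      A \<le> 1/2 * norm (2 *\<^sub>R (f Top - f (Mid i)) - 2 *\<^sub>R (f (Mid i) - f Bot))" by blast
  qed
  from bchoice[OF this] obtain idx where "\<forall>f\<in>S. idx f \<in> {0, 1} \<and>
      A \<le> 1/2 * norm (2 *\<^sub>R (f Top - f (Mid (idx f))) - 2 *\<^sub>R (f (Mid (idx f)) - f Bot))" ..
  then have idx: "f \<in> S \<Longrightarrow> idx f \<in> {0, 1}" and gap: "f \<in> S \<Longrightarrow>
      A \<le> 1/2 * norm (2 *\<^sub>R (f Top - f (Mid (idx f))) - 2 *\<^sub>R (f (Mid (idx f)) - f Bot))" for f
    by blast+
  define step where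
    "step f b = (\<lambda>p. 2 *\<^sub>R f (glue (if b = 0 then Upper (idx f) else Lower (idx f)) p))"
    for f :: "dpoint \<Rightarrow> 'a" and b :: nat
  have step: "step f b \<in> S" if "f \<in> S" for f b
  proof -
    have "(if b = 0 then Upper (idx f) else Lower (idx f)) \<in> binary_labels"
      using idx[OF that] by (auto simp: binary_labels_def)
    from dilate[OF that this] show ?thesis unfolding step_def .
  qed
  obtain f\<^sub>0 where f\<^sub>0: "f\<^sub>0 \<in> S" using \<open>S \<noteq> {}\<close> by blast
  define st where "st = foldl step f\<^sub>0"
  have st: "st s \<in> S" for s
    by (induction s rule: rev_induct) (simp_all add: st_def f\<^sub>0 step)
  define x where "x s = (1 / B) *\<^sub>R (st s Top - st s Bot)" for s
  have x0: "x (s @ [0]) = (1 / B) *\<^sub>R (2 *\<^sub>R (st s Top - st s (Mid (idx (st s)))))"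
    and x1: "x (s @ [1]) = (1 / B) *\<^sub>R (2 *\<^sub>R (st s (Mid (idx (st s))) - st s Bot))" for s
    by (simp_all add: x_def st_def step_def scaleR_diff_right)
  have halves: "(1 / B) *\<^sub>R (t - b) =
      (1/2) *\<^sub>R ((1 / B) *\<^sub>R (2 *\<^sub>R (t - m)) + (1 / B) *\<^sub>R (2 *\<^sub>R (m - b)))" for t m b :: 'a
    unfolding scaleR_add_right[symmetric] by simp
  have tree: "x s \<in> cball 0 1 \<and> x s = (1/2) *\<^sub>R (x (s @ [0]) + x (s @ [1])) \<and>
      A / B \<le> 1/2 * norm (x (s @ [0]) - x (s @ [1]))" for s
  proof (intro conjI)
    show "x s \<in> cball 0 1" using upper[OF st, of s] \<open>0 < B\<close> by (simp add: x_def)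
    show "x s = (1/2) *\<^sub>R (x (s @ [0]) + x (s @ [1]))"
      unfolding x0 x1 x_def[of s] by (rule halves)
    show "A / B \<le> 1/2 * norm (x (s @ [0]) - x (s @ [1]))"
      unfolding x0 x1 scaleR_diff_right[symmetric, of "1 / B"] norm_scaleR
      using divide_right_mono[OF gap[OF st, of s], of B] \<open>0 < B\<close> by simp
  qed
  have "0 < A / B" using \<open>0 < A\<close> \<open>0 < B\<close> by simp
  then show ?thesis
    unfolding infinite_tree_property_def
    by (intro exI[of _ "A / B"] conjI[of "0 < A / B"] exI[of _ x] ballI tree)
qed

lemma infinite_tree_property_bi_Lipschitz:
  fixes X :: "'a::real_normed_vector itself" and Y :: "'b::real_normed_vector itself"
  assumes "bi_Lipschitz_embeds Y X" "infinite_tree_property Y"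
  shows "infinite_tree_property X"
proof -
  obtain A B and g :: "'b \<Rightarrow> 'a" where AB: "0 < A" "0 < B"
    and g: "\<And>u v. A * norm (u - v) \<le> norm (g u - g v)" "\<And>u v. norm (g u - g v) \<le> B * norm (u - v)"
    using assms(1) unfolding bi_Lipschitz_embeds_def dist_norm by blast
  obtain \<delta> and y\<^sub>0 :: "nat list \<Rightarrow> 'b" where "0 < \<delta>" and y\<^sub>0: "dyadic_bush \<delta> y\<^sub>0"
    using assms(2) unfolding infinite_tree_property_iff by blast
  \<comment> \<open>On the copies of the diamond the map is \<open>a + r (diamond_map y)\<close> for a subtree \<open>y\<close>, with \<open>r\<close> a
    power of \<open>1/2\<close>; dividing the composition with \<open>g\<close> by \<open>r\<close> cancels the scale.\<close>
  define S where "S = {f. \<exists>r a y. 0 < r \<and> dyadic_bush \<delta> y \<and>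
      f = (\<lambda>p. (1 / r) *\<^sub>R g (a + r *\<^sub>R diamond_map y p))}"
  have SI: "(\<lambda>p. (1 / r) *\<^sub>R g (a + r *\<^sub>R diamond_map y p)) \<in> S" if "0 < r" "dyadic_bush \<delta> y" for r a y
    unfolding S_def mem_Collect_eq
    by (intro exI[of _ r] exI[of _ a] exI[of _ y] conjI refl that)
  have SE: "\<exists>r a y. 0 < r \<and> dyadic_bush \<delta> y \<and> f = (\<lambda>p. (1 / r) *\<^sub>R g (a + r *\<^sub>R diamond_map y p))"
    if "f \<in> S" for f
    using that unfolding S_def mem_Collect_eq .
  have bounds: "A * norm (diamond_map y p - diamond_map y q) \<le> norm (f p - f q)"
    "norm (f p - f q) \<le> B * norm (diamond_map y p - diamond_map y q)"
    if "0 < r" "f = (\<lambda>p. (1 / r) *\<^sub>R g (a + r *\<^sub>R diamond_map y p))" for f r a y p q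
  proof -
    let ?h = "\<lambda>p. a + r *\<^sub>R diamond_map y p"
    have f_diff: "norm (f p - f q) = norm (g (?h p) - g (?h q)) / r"
      unfolding that(2) scaleR_diff_right[symmetric] norm_scaleR using that(1) by simp
    have h_diff: "norm (?h p - ?h q) = r * norm (diamond_map y p - diamond_map y q)"
      unfolding add_diff_cancel_left scaleR_diff_right[symmetric] norm_scaleR using that(1) by simp
    show "A * norm (diamond_map y p - diamond_map y q) \<le> norm (f p - f q)"
      using g(1)[of "?h p" "?h q"] unfolding f_diff h_diff pos_le_divide_eq[OF that(1)]
      by (simp add: mult_ac)
    show "norm (f p - f q) \<le> B * norm (diamond_map y p - diamond_map y q)"
      using g(2)[of "?h p" "?h q"] unfolding f_diff h_diff pos_divide_le_eq[OF that(1)]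
      by (simp add: mult_ac)
  qed
  have "infinite_tree_property TYPE('a)"
  proof (rule infinite_tree_property_from_dilations)
    show "S \<noteq> {}" using SI[OF zero_less_one y\<^sub>0] by blast
    show "0 < A * \<delta>" "0 < B" using AB \<open>0 < \<delta>\<close> by simp_all
  next
    fix f c assume "f \<in> S" and c: "c \<in> binary_labels"
    then obtain r a y where r: "0 < r" and y: "dyadic_bush \<delta> y"
      and f: "f = (\<lambda>p. (1 / r) *\<^sub>R g (a + r *\<^sub>R diamond_map y p))" using SE by blast
    obtain b where b: "\<And>p. diamond_map y (glue c p) = b + (1/2) *\<^sub>R diamond_map (\<lambda>s. y (child c # s)) p"
      using diamond_map_glue_binary[OF dyadic_bush_root(2)[OF y] c] by blast
    have "(\<lambda>p. 2 *\<^sub>R f (glue c p)) =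
        (\<lambda>p. (1 / (r/2)) *\<^sub>R g ((a + r *\<^sub>R b) + (r/2) *\<^sub>R diamond_map (\<lambda>s. y (child c # s)) p))"
      unfolding f b by (simp add: scaleR_add_right add.assoc)
    then show "(\<lambda>p. 2 *\<^sub>R f (glue c p)) \<in> S"
      using SI[of "r/2" "\<lambda>s. y (child c # s)" "a + r *\<^sub>R b"] r dyadic_bush_subtree[OF y child_binary[OF c]]
      by simp
  next
    fix f assume "f \<in> S"
    then obtain r a y where r: "0 < r" and y: "dyadic_bush \<delta> y"
      and f: "f = (\<lambda>p. (1 / r) *\<^sub>R g (a + r *\<^sub>R diamond_map y p))" using SE by blast
    have "norm (f Top - f Bot) \<le> B * norm (y [])"
      using bounds(2)[OF r f, of Top Bot] by simp
    also have "\<dots> \<le> B * 1"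
      by (rule mult_left_mono[OF dyadic_bush_root(1)[OF y] less_imp_le[OF AB(2)]])
    finally show "norm (f Top - f Bot) \<le> B" by simp
    have "\<delta> \<le> norm (diamond_map y (Mid 0) - diamond_map y (Mid 1))"
      using dyadic_bush_root(3)[OF y] by (simp flip: scaleR_diff_right)
    then have "A * \<delta> \<le> A * norm (diamond_map y (Mid 0) - diamond_map y (Mid 1))"
      by (rule mult_left_mono[OF _ less_imp_le[OF AB(1)]])
    also have "\<dots> \<le> norm (f (Mid 0) - f (Mid 1))" by (rule bounds(1)[OF r f])
    finally show "A * \<delta> \<le> norm (f (Mid 0) - f (Mid 1))" .
  qed
  then show ?thesis unfolding infinite_tree_property_def .
qed

theorem theorem1p1:
  fixes \<beta> :: "omega1 \<Rightarrow> nat \<Rightarrow> omega1" and \<alpha> :: omega1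
  assumes "limit_enumeration \<beta>"
    and "separable_space (euclidean :: 'x::banach topology)"
    and "0 < \<alpha>"
    and "bi_Lipschitz_embeds TYPE('y::banach) TYPE('x)"
  shows "(DT \<beta> TYPE('x) > Ord \<alpha> \<longleftrightarrow> sub_Lipschitz_embeds (dyadic_diamond \<beta> \<alpha>) TYPE('x)) \<and>
    DT \<beta> TYPE('y) \<le> DT \<beta> TYPE('x) \<and>
    (\<not> infinite_tree_property TYPE('x) \<longrightarrow> \<not> infinite_tree_property TYPE('y))"
  using Ord_less_DT_iff_diamond_embeds[OF assms(1,3)] DT_bi_Lipschitz_mono[OF assms(1,4)]
    infinite_tree_property_bi_Lipschitz[OF assms(4)]
  by blast

end
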